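(* The sharp threshold bias for the $(a:1)$ connectivity game between RandomMaker and CleverBreaker (played on the edge set of $K_n$) is $\ln\ln n$. That is, for every $\epsilon>0$: (a) RandomMaker wins the $((1+\epsilon)\ln\ln n:1)$-biased connectivity game a.a.s. against any strategy of CleverBreaker; and (b) CleverBreaker has a strategy against which RandomMaker loses the $((1-\epsilon)\ln\ln n:1)$-biased connectivity game a.a.s.
   Context: In an $(a:1)$-biased Maker-Breaker game on $E(K_n)$, Maker and Breaker alternately take turns claiming previously unclaimed (free) edges of the complete graph $K_n$; Maker goes first, Maker claims $a$ edges in each of his turns and Breaker claims $1$ edge in each of his turns, until no free edge is left (if fewer edges remain than a player should claim, he claims all of them). Maker wins the connectivity game if the graph on all $n$ vertices formed by the edges he claimed is connected; otherwise Breaker wins. RandomMaker is a Maker each of whose moves (a move is the claiming of one edge) is a uniformly random edge among all currently free edges. CleverBreaker plays according to a strategy, i.e. a set of rules specifying what he does in every possible game situation. "Game" and "strategy" mean a sequence of games and a sequence of strategies, one for each number $n$ of vertices. "A.a.s." means with probability tending to $1$ as $n\to\infty$. Biases are integers; rounding of non-integer quantities is omitted (it does not affect the asymptotic statement). Definition: a function $f(n)$ is a sharp threshold bias of the $(a:1)$ half-random game between RandomMaker and CleverBreaker if for every $\epsilon>0$: (a) RandomMaker wins the $((1+\epsilon)f(n):1)$-biased game a.a.s. against any strategy of CleverBreaker, and (b) CleverBreaker has a strategy against which RandomMaker loses the $((1-\epsilon)f(n):1)$-biased game a.a.s. *)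

theory Defs
  imports "HOL-Probability.Probability"
begin

definition complete_edges :: "nat \<Rightarrow> nat set set" where
  "complete_edges n = {e. e \<subseteq> {..<n} \<and> card e = 2}"

text \<open>
  A game situation is the list of the edges claimed so far by both players, in the order
  in which they were claimed. Since Maker goes first and a round consists of \<open>a\<close> moves of Maker
  followed by one move of Breaker, the number of past moves determines who is to move, and the
  list records the complete history of the game.
\<close>

type_synonym history = "nat set list"
type_synonym strategy = "history \<Rightarrow> nat set"

definition maker_to_move :: "nat \<Rightarrow> nat \<Rightarrow> bool" where
  "maker_to_move a i \<longleftrightarrow> i mod (a + 1) < a"

definition free_edges :: "nat \<Rightarrow> history \<Rightarrow> nat set set" where
  "free_edges n h = complete_edges n - set h"

definition maker_edges :: "nat \<Rightarrow> history \<Rightarrow> nat set set" where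
  "maker_edges a h = {h ! i | i. i < length h \<and> maker_to_move a i}"

definition breaker_strategy :: "nat \<Rightarrow> nat \<Rightarrow> strategy \<Rightarrow> bool" where
  "breaker_strategy n a S \<longleftrightarrow>
     (\<forall>h. distinct h \<and> set h \<subseteq> complete_edges n \<and> free_edges n h \<noteq> {} \<and>
          \<not> maker_to_move a (length h) \<longrightarrow> S h \<in> free_edges n h)"

text \<open>
  The distribution of the first \<open>k\<close> moves when RandomMaker plays against \<open>S\<close>. It is used only for
  \<open>k \<le> card (complete_edges n)\<close>, so that \<^const>\<open>pmf_of_set\<close> is applied to nonempty sets only.
\<close>

primrec half_random_play :: "nat \<Rightarrow> nat \<Rightarrow> strategy \<Rightarrow> nat \<Rightarrow> history pmf" where
  "half_random_play n a S 0 = return_pmf []"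
| "half_random_play n a S (Suc k) =
     bind_pmf (half_random_play n a S k)
       (\<lambda>h. if maker_to_move a (length h)
             then map_pmf (\<lambda>e. h @ [e]) (pmf_of_set (free_edges n h))
             else return_pmf (h @ [S h]))"

definition half_random_game :: "nat \<Rightarrow> nat \<Rightarrow> strategy \<Rightarrow> history pmf" where
  "half_random_game n a S = half_random_play n a S (card (complete_edges n))"

text \<open>
  In the following, \<open>W n E\<close> states that Maker wins the game on the edges of the complete graph with
  \<open>n\<close> vertices if \<open>E\<close> is the set of all edges he has claimed at the end.
\<close>

definition maker_wins_aas ::
    "(nat \<Rightarrow> nat set set \<Rightarrow> bool) \<Rightarrow> (nat \<Rightarrow> nat) \<Rightarrow> (nat \<Rightarrow> strategy) \<Rightarrow> bool" where
  "maker_wins_aas W a S \<longleftrightarrow>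
     (\<lambda>n. measure_pmf.prob (half_random_game n (a n) (S n)) {h. W n (maker_edges (a n) h)})
       \<longlonglongrightarrow> 1"

definition maker_loses_aas ::
    "(nat \<Rightarrow> nat set set \<Rightarrow> bool) \<Rightarrow> (nat \<Rightarrow> nat) \<Rightarrow> (nat \<Rightarrow> strategy) \<Rightarrow> bool" where
  "maker_loses_aas W a S \<longleftrightarrow>
     (\<lambda>n. measure_pmf.prob (half_random_game n (a n) (S n)) {h. \<not> W n (maker_edges (a n) h)})
       \<longlonglongrightarrow> 1"

text \<open>
  Biases are integers, so a real-valued bias has to be rounded; the threshold is required not to
  depend on the direction of rounding. A negative bias (as in \<open>(1 - \<epsilon>) * f n\<close> for \<open>\<epsilon> > 1\<close>) is
  read as bias 0.
\<close>

definition rounding_of :: "(nat \<Rightarrow> nat) \<Rightarrow> (nat \<Rightarrow> real) \<Rightarrow> bool" where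
  "rounding_of a x \<longleftrightarrow> (\<forall>n. a n = nat \<lfloor>x n\<rfloor> \<or> a n = nat \<lceil>x n\<rceil>)"

definition sharp_threshold_bias ::
    "(nat \<Rightarrow> nat set set \<Rightarrow> bool) \<Rightarrow> (nat \<Rightarrow> real) \<Rightarrow> bool" where
  "sharp_threshold_bias W f \<longleftrightarrow>
     (\<forall>\<epsilon>>0.
        (\<forall>a. rounding_of a (\<lambda>n. (1 + \<epsilon>) * f n) \<longrightarrow>
           (\<forall>S. (\<forall>n. breaker_strategy n (a n) (S n)) \<longrightarrow> maker_wins_aas W a S)) \<and>
        (\<forall>a. rounding_of a (\<lambda>n. (1 - \<epsilon>) * f n) \<longrightarrow>
           (\<exists>S. (\<forall>n. breaker_strategy n (a n) (S n)) \<and> maker_loses_aas W a S)))"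

definition connected_graph :: "nat \<Rightarrow> nat set set \<Rightarrow> bool" where
  "connected_graph n E \<longleftrightarrow> (\<forall>u<n. \<forall>v<n. (u, v) \<in> {(x, y). {x, y} \<in> E}\<^sup>*)"

end

theory Submission
  imports Defs "HOL-Real_Asymp.Real_Asymp"
begin

text \<open>
  Breaker can disconnect Maker's graph by claiming all edges at one vertex \<open>v\<close>. Suppose he
  claims them one after another. When \<open>i\<close> of them are still free, each of the \<open>a\<close> Maker moves of
  a round hits \<open>v\<close> with probability about \<open>i / N\<close>, where \<open>N = n (n - 1) / 2\<close>, so such an attempt
  succeeds with probability about \<open>\<Prod>i<n. (1 - i / N) ^ a\<close>, that is, about \<open>exp (- a)\<close>. As long as
  there are vertices without a Maker edge, Breaker can start another attempt after a failure. They
  last for about \<open>(n / 2) ln n\<close> Maker moves, which leaves time for of the order of \<open>ln n / a\<close>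
  attempts. The threshold is where \<open>exp a\<close> passes \<open>ln n\<close>, that is, \<open>a = ln (ln n)\<close>.

  Both directions are proved with nonnegative functions of the game situation that do not increase
  in expectation in any move (\<open>prob_play_on_le\<close>). The product above, as a function of the number of
  free edges left at \<open>v\<close> (\<open>survival\<close>), is such a function until \<open>v\<close> is hit: it is unchanged if
  Breaker claims an edge at \<open>v\<close>, and a Maker move either reduces it to 0 or removes one factor.

  Above the threshold, call a vertex dangerous once Breaker has claimed \<open>\<delta> n\<close> edges at it, and
  consider the first \<open>R\<close> rounds, with \<open>a R\<close> about \<open>12 n ln n\<close>. Only \<open>2 R / (\<delta> n)\<close> vertices, at most
  a constant times \<open>ln n\<close>, become dangerous in that time. When \<open>v\<close> does, it has about
  \<open>(1 - \<delta>) n\<close> edges to vertices that are not dangerous yet, and the probability that Maker never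
  claims one of these is at most about \<open>exp (- (1 - \<delta>)\<^sup>2 a)\<close>, far less than \<open>1 / ln n\<close>. So with high
  probability every dangerous vertex is joined to a vertex that became dangerous later or not at
  all, and by following these edges, to a vertex that is not dangerous after \<open>R\<close> rounds. Such a
  vertex has by then many Maker edges, and all large vertex sets have a Maker edge leaving them, so
  nothing can be cut off (\<open>connected_graph_if_dangerous_escape\<close>, \<open>prob_disconnected_le\<close>).

  Below the threshold, Breaker always attacks the least vertex without a Maker edge
  (\<open>attack_strategy\<close>). His risk is bounded by one function (\<open>breaker_risk\<close>) with two summands:
  one for the event that too many attempts fail, and one, reciprocal to the number of vertices
  without a Maker edge, for the event that he runs out of targets.
\<close>

section \<open>Histories and turns\<close>

definition valid_history :: "nat \<Rightarrow> history \<Rightarrow> bool" where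
  "valid_history n h \<longleftrightarrow> distinct h \<and> set h \<subseteq> complete_edges n"

definition breaker_edges :: "nat \<Rightarrow> history \<Rightarrow> nat set set" where
  "breaker_edges a h = {h ! i | i. i < length h \<and> \<not> maker_to_move a i}"

lemma finite_complete_edges [simp]: "finite (complete_edges n)"
  unfolding complete_edges_def by (rule finite_subset[of _ "Pow {..<n}"]) auto

lemma card_complete_edges: "card (complete_edges n) = n choose 2"
  unfolding complete_edges_def by (subst n_subsets) auto

lemma real_card_complete_edges: "real (card (complete_edges n)) = real n * (real n - 1) / 2"
proof -
  have "even (n * (n - 1))" by auto
  then have "2 * (n choose 2) = n * (n - 1)" unfolding choose_two by (rule dvd_mult_div_cancel)
  then have "real (2 * (n choose 2)) = real (n * (n - 1))" by metis
  then show ?thesis by (cases n) (simp_all add: card_complete_edges algebra_simps)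
qed

lemma finite_free_edges [simp]: "finite (free_edges n h)"
  by (simp add: free_edges_def)

lemma free_edges_append: "free_edges n (h @ [e]) = free_edges n h - {e}"
  by (auto simp: free_edges_def)

lemma card_free_edges:
  assumes "valid_history n h"
  shows "card (free_edges n h) = card (complete_edges n) - length h"
  using assms by (simp add: free_edges_def valid_history_def card_Diff_subset distinct_card)

lemma valid_history_length:
  assumes "valid_history n h" shows "length h \<le> card (complete_edges n)"
  using assms by (metis valid_history_def card_mono distinct_card finite_complete_edges)

lemma valid_history_append:
  assumes "valid_history n h" "e \<in> free_edges n h"
  shows "valid_history n (h @ [e])"
  using assms by (auto simp: valid_history_def free_edges_def)

lemma valid_history_Nil [simp]: "valid_history n []"
  by (simp add: valid_history_def)

lemma maker_edges_Nil [simp]: "maker_edges a [] = {}"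
  by (simp add: maker_edges_def)

lemma breaker_edges_Nil [simp]: "breaker_edges a [] = {}"
  by (simp add: breaker_edges_def)

lemma maker_edges_image: "maker_edges a h = (!) h ` {i. i < length h \<and> maker_to_move a i}"
  by (auto simp: maker_edges_def)

lemma breaker_edges_image: "breaker_edges a h = (!) h ` {i. i < length h \<and> \<not> maker_to_move a i}"
  by (auto simp: breaker_edges_def)

lemma maker_edges_append:
  "maker_edges a (h @ [e]) =
     (if maker_to_move a (length h) then insert e (maker_edges a h) else maker_edges a h)"
proof -
  have "{i. i < length (h @ [e]) \<and> maker_to_move a i} =
      (if maker_to_move a (length h) then insert (length h) {i. i < length h \<and> maker_to_move a i}
       else {i. i < length h \<and> maker_to_move a i})"
    by (auto simp: less_Suc_eq)
  moreover have "(!) (h @ [e]) ` {i. i < length h \<and> maker_to_move a i} = maker_edges a h"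
    unfolding maker_edges_image by (rule image_cong) (auto simp: nth_append)
  ultimately show ?thesis by (simp add: maker_edges_image)
qed

lemma breaker_edges_append:
  "breaker_edges a (h @ [e]) =
     (if maker_to_move a (length h) then breaker_edges a h else insert e (breaker_edges a h))"
proof -
  have "{i. i < length (h @ [e]) \<and> \<not> maker_to_move a i} =
      (if maker_to_move a (length h) then {i. i < length h \<and> \<not> maker_to_move a i}
       else insert (length h) {i. i < length h \<and> \<not> maker_to_move a i})"
    by (auto simp: less_Suc_eq)
  moreover have "(!) (h @ [e]) ` {i. i < length h \<and> \<not> maker_to_move a i} = breaker_edges a h"
    unfolding breaker_edges_image by (rule image_cong) (auto simp: nth_append)
  ultimately show ?thesis by (simp add: breaker_edges_image)
qed

lemma maker_Un_breaker_edges: "maker_edges a h \<union> breaker_edges a h = set h"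
  by (auto simp: maker_edges_def breaker_edges_def set_conv_nth)

lemma finite_maker_edges [simp]: "finite (maker_edges a h)"
  by (metis List.finite_set finite_Un maker_Un_breaker_edges)

lemma finite_breaker_edges [simp]: "finite (breaker_edges a h)"
  by (metis List.finite_set finite_Un maker_Un_breaker_edges)

lemma maker_Int_breaker_edges:
  assumes "valid_history n h" shows "maker_edges a h \<inter> breaker_edges a h = {}"
  using assms by (auto simp: maker_edges_def breaker_edges_def valid_history_def nth_eq_iff_index_eq)

lemma breaker_edges_subset:
  assumes "valid_history n h" shows "breaker_edges a h \<subseteq> complete_edges n"
  using assms maker_Un_breaker_edges[of a h] by (auto simp: valid_history_def)

lemma free_edges_eq:
  "free_edges n h = complete_edges n - maker_edges a h - breaker_edges a h"
  using maker_Un_breaker_edges[of a h] by (auto simp: free_edges_def)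

lemma maker_edges_mono: "maker_edges a (take t h) \<subseteq> maker_edges a h"
  by (auto simp: maker_edges_def)

lemma breaker_edges_mono: "s \<le> t \<Longrightarrow> breaker_edges a (take s h) \<subseteq> breaker_edges a (take t h)"
  by (force simp: breaker_edges_def)

lemma maker_turn_Suc:
  assumes "maker_to_move a i"
  shows "Suc i div Suc a = i div Suc a" "Suc i mod Suc a = Suc (i mod Suc a)"
    "i mod Suc a < a"
  using assms by (auto simp: maker_to_move_def div_Suc mod_Suc)

lemma breaker_turn_Suc:
  assumes "\<not> maker_to_move a i"
  shows "Suc i div Suc a = Suc (i div Suc a)" "Suc i mod Suc a = 0" "i mod Suc a = a"
proof -
  have "i mod Suc a < Suc a" by simp
  with assms show "i mod Suc a = a" by (simp add: maker_to_move_def less_Suc_eq)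
  then show "Suc i div Suc a = Suc (i div Suc a)" "Suc i mod Suc a = 0"
    by (auto simp: div_Suc mod_Suc)
qed

lemma card_breaker_edges_le: "card (breaker_edges a h) \<le> length h div Suc a"
proof (induction h rule: rev_induct)
  case (snoc e h)
  show ?case
  proof (cases "maker_to_move a (length h)")
    case True
    then show ?thesis using snoc maker_turn_Suc(1)[OF True] by (simp add: breaker_edges_append)
  next
    case False
    then show ?thesis using snoc breaker_turn_Suc(1)[OF False]
      by (simp add: breaker_edges_append card_insert_if)
  qed
qed simp

section \<open>Supermartingale bounds for the half-random game\<close>

definition game_move :: "nat \<Rightarrow> nat \<Rightarrow> strategy \<Rightarrow> history \<Rightarrow> history pmf" where
  "game_move n a S h =
     (if maker_to_move a (length h)
      then map_pmf (\<lambda>e. h @ [e]) (pmf_of_set (free_edges n h))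
      else return_pmf (h @ [S h]))"

text \<open>
  Unlike \<^const>\<open>half_random_play\<close>, this play starts in an arbitrary situation and is unfolded from its
  first move. Both are needed to bound conditional probabilities, given the situation
  \<open>h\<close>, by induction on the number of moves.
\<close>

primrec play_on :: "nat \<Rightarrow> nat \<Rightarrow> strategy \<Rightarrow> history \<Rightarrow> nat \<Rightarrow> history pmf" where
  "play_on n a S h 0 = return_pmf h"
| "play_on n a S h (Suc k) = bind_pmf (game_move n a S h) (\<lambda>h'. play_on n a S h' k)"

lemma half_random_play_add:
  "half_random_play n a S (i + j) = bind_pmf (half_random_play n a S i) (\<lambda>h. play_on n a S h j)"
proof (induction j arbitrary: i)
  case 0
  then show ?case by (simp add: bind_return_pmf')
next
  case (Suc j)
  have "half_random_play n a S (i + Suc j) = half_random_play n a S (Suc i + j)" by simp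
  also have "\<dots> = bind_pmf (half_random_play n a S (Suc i)) (\<lambda>h. play_on n a S h j)"
    by (rule Suc)
  also have "\<dots> = bind_pmf (half_random_play n a S i) (\<lambda>h. play_on n a S h (Suc j))"
    by (simp add: bind_assoc_pmf game_move_def)
  finally show ?case .
qed

lemma half_random_play_eq_play_on: "half_random_play n a S k = play_on n a S [] k"
  using half_random_play_add[of n a S 0 k] by (simp add: bind_return_pmf)

lemma free_edges_nonempty:
  assumes "valid_history n h" "length h < card (complete_edges n)"
  shows "free_edges n h \<noteq> {}"
  using card_free_edges[OF assms(1)] assms(2) by auto

lemma game_move_support:
  assumes "breaker_strategy n a S" "valid_history n h" "free_edges n h \<noteq> {}"
    "h' \<in> set_pmf (game_move n a S h)"
  shows "\<exists>e\<in>free_edges n h. h' = h @ [e]"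
  using assms by (auto simp: game_move_def breaker_strategy_def valid_history_def split: if_splits)

lemma play_on_support:
  assumes "breaker_strategy n a S" "valid_history n h" "length h + k \<le> card (complete_edges n)"
    "h' \<in> set_pmf (play_on n a S h k)"
  shows "valid_history n h' \<and> length h' = length h + k \<and> take (length h) h' = h"
  using assms(2-)
proof (induction k arbitrary: h)
  case 0
  then show ?case by simp
next
  case (Suc k)
  then obtain h1 where h1: "h1 \<in> set_pmf (game_move n a S h)" "h' \<in> set_pmf (play_on n a S h1 k)"
    by auto
  have "free_edges n h \<noteq> {}" using Suc.prems by (intro free_edges_nonempty) auto
  then obtain e where e: "e \<in> free_edges n h" "h1 = h @ [e]"
    using game_move_support[OF assms(1) Suc.prems(1) _ h1(1)] by blast
  have "valid_history n h' \<and> length h' = length h1 + k \<and> take (length h1) h' = h1"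
    using Suc.prems e h1 by (intro Suc.IH) (auto intro: valid_history_append)
  moreover have "take (length h) h' = take (length h) (take (length h1) h')"
    using e by (simp add: min_def)
  ultimately show ?case using e by simp
qed

text \<open>
  The bound of a supermartingale at its end by its value at the start, with \<open>V\<close> as the
  supermartingale. The two turn conditions say that a move does not increase \<open>V\<close> in expectation; as
  Maker's move is uniform, the expectation is an average over the free edges.
\<close>

lemma emeasure_play_on_le:
  assumes S: "breaker_strategy n a S"
    and nonneg: "\<And>h. 0 \<le> V h"
    and maker: "\<And>h. valid_history n h \<Longrightarrow> length h < m \<Longrightarrow> maker_to_move a (length h) \<Longrightarrow>
        (\<Sum>e\<in>free_edges n h. V (h @ [e])) \<le> real (card (free_edges n h)) * V h"
    and breaker: "\<And>h. valid_history n h \<Longrightarrow> length h < m \<Longrightarrow> \<not> maker_to_move a (length h) \<Longrightarrow>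
        S h \<in> free_edges n h \<Longrightarrow> V (h @ [S h]) \<le> V h"
    and final: "\<And>h. valid_history n h \<Longrightarrow> length h = m \<Longrightarrow> h \<in> A \<Longrightarrow> 1 \<le> V h"
    and m: "m \<le> card (complete_edges n)"
    and h: "valid_history n h" "length h + k = m"
  shows "emeasure (measure_pmf (play_on n a S h k)) A \<le> ennreal (V h)"
  using h
proof (induction k arbitrary: h)
  case 0
  then show ?case using final[of h] nonneg by (auto simp: indicator_def)
next
  case (Suc k)
  have ne: "free_edges n h \<noteq> {}" using Suc.prems m by (intro free_edges_nonempty) auto
  have IH: "emeasure (measure_pmf (play_on n a S (h @ [e]) k)) A \<le> ennreal (V (h @ [e]))"
    if "e \<in> free_edges n h" for e
    using Suc.prems that by (intro Suc.IH) (auto intro: valid_history_append)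
  show ?case
  proof (cases "maker_to_move a (length h)")
    case True
    let ?F = "free_edges n h"
    have "game_move n a S h = map_pmf (\<lambda>e. h @ [e]) (pmf_of_set ?F)"
      using True by (simp only: game_move_def if_True)
    then have "play_on n a S h (Suc k) =
        bind_pmf (pmf_of_set ?F) (\<lambda>e. play_on n a S (h @ [e]) k)"
      by (subst play_on.simps(2)) (erule ssubst, rule bind_map_pmf)
    then have "emeasure (measure_pmf (play_on n a S h (Suc k))) A =
        (\<integral>\<^sup>+e. emeasure (measure_pmf (play_on n a S (h @ [e]) k)) A \<partial>measure_pmf (pmf_of_set ?F))"
      by (rule ssubst) (rule emeasure_bind_pmf)
    also have "\<dots> = (\<Sum>e\<in>?F. emeasure (measure_pmf (play_on n a S (h @ [e]) k)) A) / card ?F"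
      by (rule nn_integral_pmf_of_set[OF ne finite_free_edges])
    also have "\<dots> \<le> (\<Sum>e\<in>?F. ennreal (V (h @ [e]))) / card ?F"
      by (rule divide_right_mono_ennreal[OF sum_mono]) (rule IH)
    also have "\<dots> = ennreal (\<Sum>e\<in>?F. V (h @ [e])) / ennreal (real (card ?F))"
      by (subst sum_ennreal) (rule nonneg, subst ennreal_of_nat_eq_real_of_nat, rule refl)
    also have "\<dots> = ennreal ((\<Sum>e\<in>?F. V (h @ [e])) / card ?F)"
      using ne by (intro divide_ennreal sum_nonneg nonneg) (simp add: card_gt_0_iff)
    also have "\<dots> \<le> ennreal (V h)"
    proof (rule ennreal_leI)
      have "0 < real (card ?F)" using ne by (simp add: card_gt_0_iff)
      moreover have "(\<Sum>e\<in>?F. V (h @ [e])) \<le> real (card ?F) * V h"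
        using Suc.prems True by (intro maker) auto
      ultimately show "(\<Sum>e\<in>?F. V (h @ [e])) / card ?F \<le> V h"
        by (simp only: pos_divide_le_eq mult.commute[of "V h"])
    qed
    finally show ?thesis .
  next
    case False
    have Sh: "S h \<in> free_edges n h"
      using S False Suc.prems ne by (auto simp: breaker_strategy_def valid_history_def)
    then have "emeasure (measure_pmf (play_on n a S h (Suc k))) A \<le> ennreal (V (h @ [S h]))"
      using False IH[of "S h"] by (simp add: game_move_def bind_return_pmf)
    also have "\<dots> \<le> ennreal (V h)"
      using breaker[of h] False Suc.prems Sh by (intro ennreal_leI) simp
    finally show ?thesis .
  qed
qed

lemma prob_play_on_le:
  assumes "breaker_strategy n a S"
    and "\<And>h. 0 \<le> V h"
    and "\<And>h. valid_history n h \<Longrightarrow> length h < m \<Longrightarrow> maker_to_move a (length h) \<Longrightarrow>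
        (\<Sum>e\<in>free_edges n h. V (h @ [e])) \<le> real (card (free_edges n h)) * V h"
    and "\<And>h. valid_history n h \<Longrightarrow> length h < m \<Longrightarrow> \<not> maker_to_move a (length h) \<Longrightarrow>
        S h \<in> free_edges n h \<Longrightarrow> V (h @ [S h]) \<le> V h"
    and "\<And>h. valid_history n h \<Longrightarrow> length h = m \<Longrightarrow> h \<in> A \<Longrightarrow> 1 \<le> V h"
    and "m \<le> card (complete_edges n)"
    and "valid_history n h" "length h + k = m"
  shows "measure_pmf.prob (play_on n a S h k) A \<le> V h"
proof -
  have "emeasure (measure_pmf (play_on n a S h k)) A \<le> ennreal (V h)"
    by (rule emeasure_play_on_le[where m = m]) (fact assms)+
  then show ?thesis
    using assms(2)[of h] by (simp add: measure_pmf.emeasure_eq_measure)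
qed


section \<open>Sets of edges that Breaker tries to exhaust\<close>

text \<open>
  The probability that Maker misses a set of edges until Breaker has claimed all of it, if \<open>g\<close> of
  its edges are free, Breaker claims one of them in each of his moves, \<open>m\<close> Maker moves remain in the
  current round, and each Maker move hits each free edge with probability \<open>q\<close>. The true hitting
  probability of an edge varies during the game; \<open>q\<close> is a lower bound of it when Maker's
  chances are estimated from below, and an upper bound when Breaker's are.
\<close>

definition survival :: "real \<Rightarrow> nat \<Rightarrow> nat \<Rightarrow> nat \<Rightarrow> real" where
  "survival q a g m = (1 - real g * q) ^ m * (\<Prod>i<g. (1 - real i * q) ^ a)"

text \<open>
  A Breaker move on the set passes from \<open>g + 1\<close> free edges at the end of a round to \<open>g\<close> free edges at
  the beginning of the next one: it leaves the value unchanged.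
\<close>

lemma survival_Suc_0: "survival q a (Suc g) 0 = survival q a g a"
  by (simp add: survival_def)

lemma survival_0_0 [simp]: "survival q a 0 m = 1"
  by (simp add: survival_def)

lemma survival_Suc: "survival q a g (Suc m) = (1 - real g * q) * survival q a g m"
  by (simp add: survival_def)

context
  fixes q :: real and g :: nat
  assumes q: "0 \<le> q" and gq: "real g * q \<le> 1"
begin

lemma survival_factor: "i \<le> g \<Longrightarrow> 0 \<le> 1 - real i * q \<and> 1 - real i * q \<le> 1"
  using mult_right_mono[of "real i" "real g" q] q gq by auto

lemma survival_nonneg: "0 \<le> survival q a g m"
  unfolding survival_def
  by (intro mult_nonneg_nonneg zero_le_power prod_nonneg) (use survival_factor in auto)

lemma survival_antimono:
  assumes "g' \<le> g" "m' \<le> m" "m' \<le> a \<or> g' = g"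
  shows "survival q a g m \<le> survival q a g' m'"
proof -
  have "survival q a g m \<le> survival q a g' m'" if "g' = g"
    unfolding survival_def that
    by (intro mult_right_mono power_decreasing prod_nonneg)
      (use survival_factor assms in auto)
  moreover have "survival q a g m \<le> survival q a g' m'" if "g' < g"
  proof -
    have "survival q a g m \<le> 1 * (\<Prod>i<g. (1 - real i * q) ^ a)"
      unfolding survival_def
      by (intro mult_right_mono power_le_one prod_nonneg) (use survival_factor in auto)
    also have "1 * (\<Prod>i<g. (1 - real i * q) ^ a) =
        (\<Prod>i\<in>{..<Suc g'} \<union> {Suc g'..<g}. (1 - real i * q) ^ a)"
      using that by (auto intro!: prod.cong)
    also have "\<dots> = (\<Prod>i<Suc g'. (1 - real i * q) ^ a) * (\<Prod>i=Suc g'..<g. (1 - real i * q) ^ a)"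
      by (subst prod.union_disjoint) auto
    also have "\<dots> \<le> (\<Prod>i<Suc g'. (1 - real i * q) ^ a) * 1"
      using that
      by (intro mult_left_mono prod_le_1 prod_nonneg conjI power_le_one zero_le_power)
        (use survival_factor in auto)
    also have "\<dots> = (1 - real g' * q) ^ a * (\<Prod>i<g'. (1 - real i * q) ^ a)" by simp
    also have "\<dots> \<le> (1 - real g' * q) ^ m' * (\<Prod>i<g'. (1 - real i * q) ^ a)"
      using that assms
      by (intro mult_right_mono power_decreasing prod_nonneg ballI zero_le_power)
        (use survival_factor in auto)
    finally show ?thesis by (simp add: survival_def)
  qed
  ultimately show ?thesis using assms by linarith
qed

lemma survival_le_1: "survival q a g m \<le> 1"
  unfolding survival_def
  by (intro mult_le_one power_le_one prod_nonneg prod_le_1 conjI ballI zero_le_power)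
    (use survival_factor in auto)

end

text \<open>
  If at least \<open>z\<close> edges of \<open>Z\<close> remain free, each Maker move falls into \<open>Z\<close> with probability at least
  \<open>z / N\<close>, and then halves the weight \<open>(1/2) ^ card (Z \<inter> maker_edges a h)\<close>. In expectation the weight
  thus loses a factor \<open>1 - z / N / 2\<close> per Maker move, while fewer than \<open>K\<close> hits leave it above
  \<open>(1/2) ^ K\<close>. The exponent \<open>T - T div Suc a\<close> is the number of Maker moves among the first \<open>T\<close> moves.
  The condition on Breaker's edges is the one at time \<open>T\<close>; it implies that \<open>z\<close> edges of \<open>Z\<close> have
  been free all along, because both players' edge sets only grow.
\<close>

lemma prob_few_maker_edges_le:
  assumes S: "breaker_strategy n a S" and Z: "Z \<subseteq> complete_edges n"
    and z: "0 \<le> z" "z \<le> real (card (complete_edges n))"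
    and T: "T \<le> card (complete_edges n)"
  shows "measure_pmf.prob (half_random_play n a S T)
      {h. card (Z \<inter> maker_edges a h) < K \<and>
          z + real K + real (card (Z \<inter> breaker_edges a h)) \<le> real (card Z)}
    \<le> 2 ^ K * (1 - z / real (card (complete_edges n)) / 2) ^ (T - T div Suc a)"
proof -
  define N where "N = real (card (complete_edges n))"
  define w where "w = z / N"
  define \<rho> where "\<rho> = 1 - w / 2"
  define cond where "cond h \<longleftrightarrow> card (Z \<inter> maker_edges a h) < K \<and>
      z + real K + real (card (Z \<inter> breaker_edges a h)) \<le> real (card Z)" for h
  \<comment> \<open>the number of Maker moves among the first \<open>i\<close> moves\<close>
  define mm where "mm i = i - i div Suc a" for i
  define V where "V h = (if cond h then 2 ^ K * (1/2) ^ card (Z \<inter> maker_edges a h)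
      * \<rho> ^ (mm T - mm (length h)) else 0)" for h
  have zN: "z \<le> N" "0 \<le> N" using z by (auto simp: N_def)
  have w: "w \<le> 1" unfolding w_def using zN by (intro divide_le_eq_1[THEN iffD2]) linarith
  then have \<rho>: "0 < \<rho>" by (simp add: \<rho>_def)
  have finZ: "finite Z" by (rule finite_subset[OF Z]) simp
  have mono_cond: "cond h" if "cond (h @ [e])" for h e
  proof -
    have "card (Z \<inter> maker_edges a h) \<le> card (Z \<inter> maker_edges a (h @ [e]))"
      "card (Z \<inter> breaker_edges a h) \<le> card (Z \<inter> breaker_edges a (h @ [e]))"
      using finZ by (auto intro!: card_mono simp: maker_edges_append breaker_edges_append)
    then show ?thesis using that unfolding cond_def by linarith
  qed
  have Vnonneg: "0 \<le> V h" for h using \<rho> by (simp add: V_def)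
  have mm_maker: "mm (Suc i) = Suc (mm i)" if "maker_to_move a i" for i
    using maker_turn_Suc(1)[OF that] div_le_dividend[of i "Suc a"] by (simp add: mm_def Suc_diff_le)
  have mm_breaker: "mm (Suc i) = mm i" if "\<not> maker_to_move a i" for i
    using breaker_turn_Suc(1)[OF that] by (simp add: mm_def)
  have "mm i \<le> mm (Suc i)" for i
    using mm_maker[of i] mm_breaker[of i] by fastforce
  then have mm_mono: "mm i \<le> mm j" if "i \<le> j" for i j
    by (rule lift_Suc_mono_le) (rule that)
  have "measure_pmf.prob (play_on n a S [] T) {h. cond h} \<le> V []"
  proof (rule prob_play_on_le[where m = T])
    fix h assume h: "valid_history n h" "length h < T" "maker_to_move a (length h)"
    let ?F = "free_edges n h"
    show "(\<Sum>e\<in>?F. V (h @ [e])) \<le> real (card ?F) * V h"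
    proof (cases "cond h")
      case False
      then have "V (h @ [e]) = 0" for e using mono_cond by (auto simp: V_def)
      then show ?thesis using Vnonneg by simp
    next
      case True
      define Y where "Y = 2 ^ K * (1/2) ^ card (Z \<inter> maker_edges a h) * \<rho> ^ (mm T - mm (Suc (length h)))"
      have Y: "0 \<le> Y" using \<rho> by (simp add: Y_def)
      note mm_maker[OF h(3)]
      moreover have "mm (Suc (length h)) \<le> mm T" using h by (intro mm_mono) simp
      ultimately have "mm T - mm (length h) = Suc (mm T - mm (Suc (length h)))" by simp
      then have Vh: "V h = \<rho> * Y" using True by (simp add: V_def Y_def)
      have Vin: "V (h @ [e]) \<le> Y / 2" if "e \<in> Z \<inter> ?F" for e
      proof -
        have "e \<notin> maker_edges a h" using that maker_Un_breaker_edges[of a h]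
          by (auto simp: free_edges_def)
        then have "card (Z \<inter> maker_edges a (h @ [e])) = Suc (card (Z \<inter> maker_edges a h))"
          using that h(3) by (simp add: maker_edges_append)
        then have "2 ^ K * (1/2) ^ card (Z \<inter> maker_edges a (h @ [e])) *
            \<rho> ^ (mm T - mm (length (h @ [e]))) = Y / 2"
          by (simp add: Y_def)
        then show ?thesis using Y by (simp only: V_def split: if_split) simp
      qed
      have Vout: "V (h @ [e]) \<le> Y" if "e \<in> ?F - Z" for e
      proof -
        have "2 ^ K * (1/2) ^ card (Z \<inter> maker_edges a (h @ [e])) *
            \<rho> ^ (mm T - mm (length (h @ [e]))) = Y"
          using that h(3) by (simp add: Y_def maker_edges_append)
        then show ?thesis using Y by (simp only: V_def split: if_split) simp
      qed
      have "(\<Sum>e\<in>?F. V (h @ [e])) = (\<Sum>e\<in>Z \<inter> ?F. V (h @ [e])) + (\<Sum>e\<in>?F - Z. V (h @ [e]))"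
        by (subst sum.union_disjoint[symmetric]) (auto intro: sum.cong)
      also have "\<dots> \<le> (\<Sum>e\<in>Z \<inter> ?F. Y / 2) + (\<Sum>e\<in>?F - Z. Y)"
        by (intro add_mono sum_mono Vin Vout)
      also have "\<dots> = (real (card (Z \<inter> ?F)) + real (card (?F - Z)) - real (card (Z \<inter> ?F)) / 2) * Y"
        by (simp add: algebra_simps)
      also have "real (card (Z \<inter> ?F)) + real (card (?F - Z)) = real (card ?F)"
        using card_Int_Diff[of ?F Z] by (simp add: Int_commute)
      finally have 1: "(\<Sum>e\<in>?F. V (h @ [e])) \<le> (real (card ?F) - real (card (Z \<inter> ?F)) / 2) * Y" .
      have "card (Z \<inter> ?F) + card (Z \<inter> maker_edges a h) + card (Z \<inter> breaker_edges a h) = card Z"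
      proof -
        have "Z = (Z \<inter> ?F) \<union> ((Z \<inter> maker_edges a h) \<union> (Z \<inter> breaker_edges a h))"
          using Z by (auto simp: free_edges_eq[of n h a])
        moreover have "card ((Z \<inter> ?F) \<union> ((Z \<inter> maker_edges a h) \<union> (Z \<inter> breaker_edges a h))) =
            card (Z \<inter> ?F) + (card (Z \<inter> maker_edges a h) + card (Z \<inter> breaker_edges a h))"
          using maker_Int_breaker_edges[OF h(1), of a] finZ
          by (subst card_Un_disjoint, auto simp: free_edges_eq[of n h a])
             (subst card_Un_disjoint, auto)
        ultimately show ?thesis by simp
      qed
      then have zF: "z \<le> real (card (Z \<inter> ?F))" using True unfolding cond_def by linarith
      have F: "real (card ?F) \<le> N" unfolding N_def
        by (simp add: card_mono free_edges_def)
      have "w * real (card ?F) \<le> w * N"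
        using F zN z by (intro mult_left_mono) (simp_all add: w_def)
      also have "w * N \<le> z" using z zN by (simp add: w_def)
      finally have "real (card ?F) - real (card (Z \<inter> ?F)) / 2 \<le> real (card ?F) * \<rho>"
        using zF by (simp add: \<rho>_def algebra_simps)
      then have "(real (card ?F) - real (card (Z \<inter> ?F)) / 2) * Y \<le> real (card ?F) * \<rho> * Y"
        by (rule mult_right_mono) (rule Y)
      with 1 show ?thesis by (simp add: Vh mult.assoc)
    qed
  next
    fix h assume h: "valid_history n h" "length h < T" "\<not> maker_to_move a (length h)"
    note mm_breaker[OF h(3)]
    then show "V (h @ [S h]) \<le> V h"
      using mono_cond[of h "S h"] h(3) \<rho> by (simp add: V_def maker_edges_append)
  next
    fix h assume "valid_history n h" "length h = T" "h \<in> {h. cond h}"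
    then have "cond h" and len: "length h = T" by auto
    then have "card (Z \<inter> maker_edges a h) \<le> K" by (simp add: cond_def)
    then have "(1::real) \<le> 2 ^ (K - card (Z \<inter> maker_edges a h))" by simp
    also have "\<dots> = 2 ^ K * (1/2) ^ card (Z \<inter> maker_edges a h)"
      using \<open>card _ \<le> K\<close> by (simp add: power_diff power_one_over)
    finally show "1 \<le> V h" using \<open>cond h\<close> len by (simp add: V_def)
  qed (use S T Vnonneg in auto)
  also have "V [] \<le> 2 ^ K * \<rho> ^ mm T" using \<rho> by (simp add: V_def mm_def)
  finally show ?thesis
    by (simp add: half_random_play_eq_play_on cond_def mm_def \<rho>_def w_def N_def)
qed

text \<open>
  At most \<open>N\<close> edges are free, so a Maker move hits each free edge with probability at least
  \<open>1 / N\<close>, and \<^const>\<open>survival\<close> with \<open>q = 1 / N\<close> does not increase in expectation, whatever Breaker does: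
  if he claims an edge of \<open>Z\<close>, it does not change, and if he claims another edge, the
  factors of a new round are added. At the end no edge is free, and its value is 1 unless
  Maker has hit \<open>Z\<close>.
\<close>

lemma prob_breaker_exhausts_le:
  assumes S: "breaker_strategy n a S" and p: "valid_history n p"
    and Z: "Z \<subseteq> complete_edges n" and g: "g \<le> card (Z \<inter> free_edges n p)"
  shows "measure_pmf.prob (play_on n a S p (card (complete_edges n) - length p))
      {h. Z \<inter> maker_edges a h = {}}
    \<le> survival (1 / real (card (complete_edges n))) a g 0"
proof -
  define N where "N = card (complete_edges n)"
  define q where "q = 1 / real N"
  define fr where "fr h = card (Z \<inter> free_edges n h)" for h
  define V where "V h = (if Z \<inter> maker_edges a h = {}
      then survival q a (fr h) (a - length h mod Suc a) else 0)" for h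
  have q: "0 \<le> q" by (simp add: q_def)
  have frN: "real (fr h) * q \<le> 1" for h
  proof -
    have "fr h \<le> N" unfolding fr_def N_def
      by (intro card_mono) (auto simp: free_edges_def)
    then show ?thesis by (auto simp: q_def divide_le_eq)
  qed
  have Vnonneg: "0 \<le> V h" for h
    by (simp add: V_def survival_nonneg[OF q frN])
  have "measure_pmf.prob (play_on n a S p (N - length p)) {h. Z \<inter> maker_edges a h = {}} \<le> V p"
  proof (rule prob_play_on_le[where m = N])
    fix h assume h: "valid_history n h" "length h < N" "maker_to_move a (length h)"
    let ?F = "free_edges n h"
    show "(\<Sum>e\<in>?F. V (h @ [e])) \<le> real (card ?F) * V h"
    proof (cases "Z \<inter> maker_edges a h = {}")
      case False
      then have "V (h @ [e]) = 0" for e by (auto simp: V_def maker_edges_append)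
      then show ?thesis using Vnonneg by simp
    next
      case True
      define m where "m = a - Suc (length h mod Suc a)"
      have m: "a - length h mod Suc a = Suc m" "a - length (h @ [e]) mod Suc a = m" for e
        using maker_turn_Suc(2,3)[OF h(3)] by (simp_all add: m_def)
      define Y where "Y = survival q a (fr h) m"
      have Y: "0 \<le> Y" by (simp add: Y_def survival_nonneg[OF q frN])
      have Vh: "V h = (1 - real (fr h) * q) * Y"
        using True unfolding V_def m(1) survival_Suc Y_def by simp
      have Vin: "V (h @ [e]) = 0" if "e \<in> Z" for e
        using that h(3) by (simp add: V_def maker_edges_append)
      have Vout: "V (h @ [e]) = Y" if "e \<notin> Z" for e
      proof -
        have "Z \<inter> (free_edges n h - {e}) = Z \<inter> free_edges n h" using that by auto
        then show ?thesis using that h(3) True m(2)[of e]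
          by (simp add: V_def Y_def fr_def maker_edges_append free_edges_append)
      qed
      have "(\<Sum>e\<in>?F. V (h @ [e])) = (\<Sum>e\<in>Z \<inter> ?F. V (h @ [e])) + (\<Sum>e\<in>?F - Z. V (h @ [e]))"
        by (subst sum.union_disjoint[symmetric]) (auto intro: sum.cong)
      also have "\<dots> = real (card (?F - Z)) * Y"
        using Vin Vout by simp
      also have "real (card (?F - Z)) = real (card ?F) - real (fr h)"
        using card_Int_Diff[of ?F Z] by (simp add: Int_commute fr_def)
      also have "\<dots> \<le> real (card ?F) * (1 - real (fr h) * q)"
      proof -
        have "card ?F \<le> N" unfolding N_def by (simp add: card_mono free_edges_def)
        then have "real (card ?F) * q \<le> 1" by (auto simp: q_def divide_le_eq)
        from mult_left_mono[OF this, of "real (fr h)"] show ?thesis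
          by (simp add: algebra_simps)
      qed
      finally show ?thesis using Y by (simp add: Vh mult.assoc mult_right_mono)
    qed
  next
    fix h assume h: "valid_history n h" "length h < N" "\<not> maker_to_move a (length h)"
      and Sh: "S h \<in> free_edges n h"
    show "V (h @ [S h]) \<le> V h"
    proof (cases "Z \<inter> maker_edges a h = {}")
      case False
      then show ?thesis using h(3) by (simp add: V_def maker_edges_append)
    next
      case True
      have Vh: "V h = survival q a (fr h) 0"
        using True breaker_turn_Suc(3)[OF h(3)] by (simp add: V_def)
      have Vh': "V (h @ [S h]) = survival q a (fr (h @ [S h])) a"
        using True breaker_turn_Suc(2)[OF h(3)] h(3) by (simp add: V_def maker_edges_append)
      show ?thesis
      proof (cases "S h \<in> Z")
        case True
        have "Z \<inter> free_edges n h = insert (S h) (Z \<inter> free_edges n (h @ [S h]))"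
          using True Sh by (auto simp: free_edges_append)
        then have "fr h = Suc (fr (h @ [S h]))"
          by (simp add: fr_def free_edges_append)
        then show ?thesis by (simp add: Vh Vh' survival_Suc_0)
      next
        case False
        then have "fr (h @ [S h]) = fr h"
          by (auto simp: fr_def free_edges_append intro: arg_cong[where f = card])
        then show ?thesis
          unfolding Vh Vh' by (simp add: survival_antimono[OF q frN])
      qed
    qed
  next
    fix h assume h: "valid_history n h" "length h = N" "h \<in> {h. Z \<inter> maker_edges a h = {}}"
    have "card (free_edges n h) = 0" using card_free_edges[OF h(1)] h(2) by (simp add: N_def)
    then have "fr h = 0" by (simp add: fr_def)
    then show "1 \<le> V h" using h(3) by (simp add: V_def)
  qed (use S p Vnonneg valid_history_length[OF p] in \<open>auto simp: N_def\<close>)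
  also have "V p \<le> survival q a g 0"
    using survival_antimono[OF q frN, of g p 0 "a - length p mod Suc a" a] g
      survival_nonneg[OF q, of g a 0] mult_right_mono[of "real g" "real (fr p)" q] frN[of p] q
    by (auto simp: V_def fr_def)
  finally show ?thesis by (simp add: N_def q_def)
qed


section \<open>Dangerous vertices and connectivity\<close>

definition edges_between :: "nat set \<Rightarrow> nat set \<Rightarrow> nat set set" where
  "edges_between A B = (\<lambda>(u, w). {u, w}) ` (A \<times> B)"

lemma edges_betweenI: "u \<in> A \<Longrightarrow> w \<in> B \<Longrightarrow> {u, w} \<in> edges_between A B"
  by (auto simp: edges_between_def)

lemma edges_betweenE:
  assumes "e \<in> edges_between A B"
  obtains u w where "u \<in> A" "w \<in> B" "e = {u, w}"
  using assms by (auto simp: edges_between_def)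

lemma finite_edges_between: "finite A \<Longrightarrow> finite B \<Longrightarrow> finite (edges_between A B)"
  by (simp add: edges_between_def)

lemma card_edges_between:
  assumes "A \<inter> B = {}"
  shows "card (edges_between A B) = card A * card B"
proof -
  have "inj_on (\<lambda>(u, w). {u, w}) (A \<times> B)"
  proof (rule inj_onI, clarify)
    fix u w u' w' assume "u \<in> A" "w \<in> B" "u' \<in> A" "w' \<in> B" "{u, w} = {u', w'}"
    then show "u = u' \<and> w = w'" using assms by (auto simp: doubleton_eq_iff)
  qed
  then show ?thesis unfolding edges_between_def
    by (subst card_image) (simp_all add: card_cartesian_product)
qed

lemma edges_between_subset:
  assumes "A \<subseteq> {..<n}" "B \<subseteq> {..<n}" "A \<inter> B = {}"
  shows "edges_between A B \<subseteq> complete_edges n"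
proof
  fix e assume "e \<in> edges_between A B"
  then obtain u w where uw: "u \<in> A" "w \<in> B" "e = {u, w}" by (rule edges_betweenE)
  moreover from this have "u \<noteq> w" using assms by blast
  ultimately show "e \<in> complete_edges n" using assms by (auto simp: complete_edges_def)
qed

definition breaker_degree :: "nat \<Rightarrow> history \<Rightarrow> nat \<Rightarrow> nat" where
  "breaker_degree a h v = card {e \<in> breaker_edges a h. v \<in> e}"

definition dangerous :: "nat \<Rightarrow> nat \<Rightarrow> real \<Rightarrow> history \<Rightarrow> nat set" where
  "dangerous n a D h = {v. v < n \<and> D \<le> real (breaker_degree a h v)}"

text \<open>
  The threshold is passed with the last of the first \<open>t\<close> moves. For \<open>t = 0\<close> this is false, since
  \<open>t - 1 = t\<close> then.
\<close>

definition becomes_dangerous :: "nat \<Rightarrow> real \<Rightarrow> history \<Rightarrow> nat \<Rightarrow> nat \<Rightarrow> bool" where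
  "becomes_dangerous a D h t v \<longleftrightarrow>
     real (breaker_degree a (take (t - 1) h) v) < D \<and> D \<le> real (breaker_degree a (take t h) v)"

lemma finite_dangerous [simp]: "finite (dangerous n a D h)"
  by (simp add: dangerous_def)

lemma breaker_degree_mono:
  assumes "s \<le> t"
  shows "breaker_degree a (take s h) v \<le> breaker_degree a (take t h) v"
  unfolding breaker_degree_def
  by (rule card_mono) (use breaker_edges_mono[OF assms, of a h] in auto)

lemma sum_breaker_degree:
  assumes "valid_history n h"
  shows "(\<Sum>v<n. breaker_degree a h v) = 2 * card (breaker_edges a h)"
  unfolding breaker_degree_def
proof (rule sum_multicount)
  show "\<forall>e\<in>breaker_edges a h. card {v \<in> {..<n}. v \<in> e} = 2"
  proof
    fix e assume "e \<in> breaker_edges a h"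
    then have e: "e \<subseteq> {..<n}" "card e = 2"
      using breaker_edges_subset[OF assms] by (auto simp: complete_edges_def)
    then have "{v \<in> {..<n}. v \<in> e} = e" by auto
    with e show "card {v \<in> {..<n}. v \<in> e} = 2" by simp
  qed
qed auto

text \<open>
  Each of Breaker's edges contributes to the Breaker degree of two vertices, and
  \<open>length h div Suc a\<close> is the number of his moves.
\<close>

lemma card_dangerous_le:
  assumes "valid_history n h" "0 < D"
  shows "real (card (dangerous n a D h)) \<le> 2 * real (length h div Suc a) / D"
proof -
  have "real (card (dangerous n a D h)) * D \<le> (\<Sum>v\<in>dangerous n a D h. real (breaker_degree a h v))"
    by (rule order_trans[OF _ sum_mono[of _ "\<lambda>_. D"]]) (auto simp: dangerous_def)
  also have "\<dots> \<le> (\<Sum>v<n. real (breaker_degree a h v))"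
    by (rule sum_mono2) (auto simp: dangerous_def)
  also have "\<dots> = 2 * real (card (breaker_edges a h))"
    using sum_breaker_degree[OF assms(1), of a] by (simp flip: of_nat_sum)
  also have "\<dots> \<le> 2 * real (length h div Suc a)"
    using card_breaker_edges_le[of a h] by simp
  finally show ?thesis using assms(2) by (subst pos_le_divide_eq)
qed

lemma disconnected_small_closed_set:
  assumes "\<not> connected_graph n E"
  obtains C where "C \<subseteq> {..<n}" "C \<noteq> {}" "2 * card C \<le> n" "edges_between C ({..<n} - C) \<inter> E = {}"
proof -
  obtain u v where uv: "u < n" "v < n" "(u, v) \<notin> {(x, y). {x, y} \<in> E}\<^sup>*"
    using assms unfolding connected_graph_def by blast
  define C where "C = {w. w < n \<and> (u, w) \<in> {(x, y). {x, y} \<in> E}\<^sup>*}"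
  have C: "C \<subseteq> {..<n}" "u \<in> C" "v \<notin> C" using uv by (auto simp: C_def)
  have closed: "edges_between C ({..<n} - C) \<inter> E = {}"
  proof (rule ccontr)
    assume "edges_between C ({..<n} - C) \<inter> E \<noteq> {}"
    then obtain x y where xy: "x \<in> C" "y < n" "y \<notin> C" "{x, y} \<in> E"
      by (auto elim!: edges_betweenE)
    then have "(u, y) \<in> {(x, y). {x, y} \<in> E}\<^sup>*"
      unfolding C_def by (auto intro: rtrancl_into_rtrancl)
    then show False using xy by (auto simp: C_def)
  qed
  have swap: "edges_between ({..<n} - C) C = edges_between C ({..<n} - C)"
    by (auto simp: edges_between_def image_def insert_commute)
  have card: "card ({..<n} - C) = n - card C" "card C \<le> n"
    using C(1) card_mono[of "{..<n}" C] by (auto simp: card_Diff_subset finite_subset)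
  show ?thesis
  proof (cases "2 * card C \<le> n")
    case True
    then show ?thesis using C closed by (intro that[of C]) auto
  next
    case False
    have "{..<n} - ({..<n} - C) = C" using C by auto
    then show ?thesis using False C closed card uv swap by (intro that[of "{..<n} - C"]) auto
  qed
qed

text \<open>
  If Maker's graph is disconnected, there is a nonempty set \<open>C\<close> of at most half of the vertices that
  no Maker edge leaves. Were all vertices of \<open>C\<close> dangerous at time \<open>T\<close>, the one that became
  dangerous last would have an edge to a vertex that was not dangerous at that moment; this vertex
  belongs to \<open>C\<close>, so it became dangerous still later, a contradiction. Hence \<open>C\<close> contains a vertex
  that is not dangerous at time \<open>T\<close>. With its Maker neighbours, \<open>C\<close> has at least \<open>K\<close> elements, and
  then a Maker edge leaves \<open>C\<close> already at time \<open>T\<close>.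
\<close>

lemma connected_graph_if_dangerous_escape:
  assumes D: "0 < D"
    and cuts: "\<And>C. C \<subseteq> {..<n} \<Longrightarrow> K \<le> card C \<Longrightarrow> 2 * card C \<le> n \<Longrightarrow> C \<noteq> {} \<Longrightarrow>
      edges_between C ({..<n} - C) \<inter> maker_edges a (take T h) \<noteq> {}"
    and degrees: "\<And>w. w < n \<Longrightarrow> real (breaker_degree a (take T h) w) < D \<Longrightarrow>
      K \<le> card (edges_between {w} ({..<n} - {w}) \<inter> maker_edges a (take T h))"
    and escape: "\<And>v t. v < n \<Longrightarrow> t \<le> T \<Longrightarrow> becomes_dangerous a D h t v \<Longrightarrow>
      edges_between {v} ({..<n} - dangerous n a D (take t h)) \<inter> maker_edges a h \<noteq> {}"
  shows "connected_graph n (maker_edges a h)"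
proof (rule ccontr)
  assume "\<not> connected_graph n (maker_edges a h)"
  then obtain C where C: "C \<subseteq> {..<n}" "C \<noteq> {}" "2 * card C \<le> n"
      and closed: "edges_between C ({..<n} - C) \<inter> maker_edges a h = {}"
    by (rule disconnected_small_closed_set)
  have finC: "finite C" using C(1) by (rule finite_subset) simp
  have stay: "w \<in> C" if "v \<in> C" "w < n" "{v, w} \<in> maker_edges a h" for v w
    using closed that edges_betweenI[of v C w "{..<n} - C"] by auto
  \<comment> \<open>the time at which \<open>v\<close> becomes dangerous\<close>
  define dt where "dt v = (LEAST t. D \<le> real (breaker_degree a (take t h) v))" for v
  have "\<exists>w\<in>C. real (breaker_degree a (take T h) w) < D"
  proof (rule ccontr)
    assume "\<not> ?thesis"
    then have all: "D \<le> real (breaker_degree a (take T h) w)" if "w \<in> C" for w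
      using that by force
    have dt: "D \<le> real (breaker_degree a (take (dt w) h) w)" "dt w \<le> T" if "w \<in> C" for w
      unfolding dt_def
      using all[OF that] by (rule LeastI, intro Least_le all that)
    have "Max (dt ` C) \<in> dt ` C" using finC C(2) by (intro Max_in) auto
    then obtain v where "v \<in> C" "Max (dt ` C) = dt v" by auto
    moreover from this have "dt w \<le> dt v" if "w \<in> C" for w
      using finC that Max_ge[of "dt ` C" "dt w"] by simp
    ultimately have v: "v \<in> C" "\<And>w. w \<in> C \<Longrightarrow> dt w \<le> dt v" by auto
    have "breaker_degree a (take 0 h) v = 0" by (simp add: breaker_degree_def)
    then have "dt v \<noteq> 0" using dt(1)[OF v(1)] D by (intro notI) simp
    then have "\<not> D \<le> real (breaker_degree a (take (dt v - 1) h) v)"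
      using not_less_Least[of "dt v - 1" "\<lambda>t. D \<le> real (breaker_degree a (take t h) v)"]
      by (simp add: dt_def)
    then have "becomes_dangerous a D h (dt v) v"
      using dt(1)[OF v(1)] by (simp add: becomes_dangerous_def)
    then have "edges_between {v} ({..<n} - dangerous n a D (take (dt v) h)) \<inter> maker_edges a h \<noteq> {}"
      using v C dt by (intro escape) auto
    then obtain w where w: "w < n" "w \<notin> dangerous n a D (take (dt v) h)" "{v, w} \<in> maker_edges a h"
      by (auto elim!: edges_betweenE)
    then have "w \<in> C" using stay v by blast
    then have "D \<le> real (breaker_degree a (take (dt w) h) w)" "dt w \<le> dt v" using dt v by auto
    then have "D \<le> real (breaker_degree a (take (dt v) h) w)"
      using breaker_degree_mono[of "dt w" "dt v" a h w] by linarith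
    then show False using w by (simp add: dangerous_def)
  qed
  then obtain w where w: "w \<in> C" "real (breaker_degree a (take T h) w) < D" by blast
  then have "w < n" using C by auto
  have "K \<le> card (edges_between {w} ({..<n} - {w}) \<inter> maker_edges a (take T h))"
    using w \<open>w < n\<close> by (intro degrees)
  also have "\<dots> \<le> card (edges_between {w} (C - {w}))"
  proof (rule card_mono)
    show "edges_between {w} ({..<n} - {w}) \<inter> maker_edges a (take T h) \<subseteq> edges_between {w} (C - {w})"
    proof
      fix e assume e: "e \<in> edges_between {w} ({..<n} - {w}) \<inter> maker_edges a (take T h)"
      then obtain x where x: "x < n" "x \<noteq> w" "e = {w, x}" by (auto elim!: edges_betweenE)
      moreover have "e \<in> maker_edges a h" using e maker_edges_mono[of a T h] by auto
      ultimately have "x \<in> C" using stay[of w x] w by auto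
      then show "e \<in> edges_between {w} (C - {w})" using x by (auto intro: edges_betweenI)
    qed
  qed (use finC in \<open>auto intro: finite_edges_between\<close>)
  also have "\<dots> = card (C - {w})" by (subst card_edges_between) auto
  also have "\<dots> \<le> card C" using finC by (intro card_mono) auto
  finally have "edges_between C ({..<n} - C) \<inter> maker_edges a (take T h) \<noteq> {}"
    using C by (intro cuts)
  then show False using closed maker_edges_mono[of a T h] by blast
qed

section \<open>The probability that Maker's graph is disconnected\<close>

lemma sum_power_card_Pow:
  fixes x :: real
  assumes "finite A"
  shows "(\<Sum>C\<in>Pow A. x ^ card C) = (1 + x) ^ card A"
  using prod_add[OF assms, of "\<lambda>_. x" "\<lambda>_. 1"] by (simp add: add.commute)


lemma half_random_game_split:
  assumes "t \<le> card (complete_edges n)"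
  shows "half_random_game n a S =
    bind_pmf (half_random_play n a S t) (\<lambda>p. play_on n a S p (card (complete_edges n) - t))"
  using half_random_play_add[of n a S t "card (complete_edges n) - t"] assms
  by (simp add: half_random_game_def)

lemma half_random_play_support:
  assumes "breaker_strategy n a S" "t \<le> card (complete_edges n)"
    "p \<in> set_pmf (half_random_play n a S t)"
  shows "valid_history n p" "length p = t"
  using play_on_support[OF assms(1), of "[]" t p] assms by (simp_all add: half_random_play_eq_play_on)

lemma prob_half_random_game_take:
  assumes S: "breaker_strategy n a S" and t: "t \<le> card (complete_edges n)"
  shows "measure_pmf.prob (half_random_game n a S) {h. P (take t h)} =
    measure_pmf.prob (half_random_play n a S t) {h. P h}"
proof -
  have "map_pmf (take t) (half_random_game n a S) =
      bind_pmf (half_random_play n a S t)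
        (\<lambda>p. map_pmf (take t) (play_on n a S p (card (complete_edges n) - t)))"
    by (simp add: half_random_game_split[OF t] map_bind_pmf)
  also have "\<dots> = bind_pmf (half_random_play n a S t) return_pmf"
  proof (rule bind_pmf_cong[OF refl])
    fix p assume "p \<in> set_pmf (half_random_play n a S t)"
    then have p: "valid_history n p" "length p = t" using half_random_play_support[OF S t] by auto
    have "map_pmf (take t) (play_on n a S p (card (complete_edges n) - t)) =
        map_pmf (\<lambda>_. p) (play_on n a S p (card (complete_edges n) - t))"
      using play_on_support[OF S p(1), of "card (complete_edges n) - t"] p(2) t
      by (intro map_pmf_cong refl) auto
    then show "map_pmf (take t) (play_on n a S p (card (complete_edges n) - t)) = return_pmf p"
      by (simp add: map_pmf_const)
  qed
  also have "\<dots> = half_random_play n a S t" by (rule bind_return_pmf')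
  finally have "half_random_play n a S t = map_pmf (take t) (half_random_game n a S)" by simp
  then show ?thesis by (simp add: measure_map_pmf vimage_def)
qed

lemma prob_bex_le:
  assumes "finite I"
  shows "measure_pmf.prob M {h. \<exists>i\<in>I. P i h} \<le> (\<Sum>i\<in>I. measure_pmf.prob M {h. P i h})"
proof -
  have "{h. \<exists>i\<in>I. P i h} = (\<Union>i\<in>I. {h. P i h})" by auto
  then show ?thesis
    using measure_pmf.finite_measure_subadditive_finite[OF assms, of "\<lambda>i. {h. P i h}" M] by simp
qed

lemma sum_prob_le_bound:
  assumes "finite I" and B: "\<And>h. h \<in> set_pmf M \<Longrightarrow> real (card {i \<in> I. P i h}) \<le> B"
  shows "(\<Sum>i\<in>I. measure_pmf.prob M {h. P i h}) \<le> B"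
proof -
  have "(\<Sum>i\<in>I. measure_pmf.prob M {h. P i h}) =
      (\<Sum>i\<in>I. measure_pmf.expectation M (indicator {h. P i h}))" by simp
  also have "\<dots> = measure_pmf.expectation M (\<lambda>h. \<Sum>i\<in>I. indicator {h. P i h} h)"
    by (rule Bochner_Integration.integral_sum[symmetric])
      (simp add: measure_pmf.emeasure_eq_measure)
  also have "\<dots> \<le> B"
  proof (rule measure_pmf.integral_le_const)
    show "integrable (measure_pmf M) (\<lambda>h. \<Sum>i\<in>I. indicator {h. P i h} h :: real)"
      by (intro Bochner_Integration.integrable_sum) (simp add: measure_pmf.emeasure_eq_measure)
    have "(\<Sum>i\<in>I. indicator {h. P i h} h) = real (card {i \<in> I. P i h})" for h
      using assms(1) by (simp add: indicator_def sum.If_cases Int_def)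
    then show "AE h in measure_pmf M. (\<Sum>i\<in>I. indicator {h. P i h} h) \<le> B"
      using B by (simp add: AE_measure_pmf_iff)
  qed
  finally show ?thesis .
qed

text \<open>
  Given that \<open>v\<close> becomes dangerous with move \<open>t\<close>, Breaker has fewer than \<open>D + 1\<close> edges at \<open>v\<close>, and at
  most \<open>2 R / D\<close> vertices are dangerous, where \<open>R = T div Suc a\<close>. So there are at least \<open>g\<close> free edges
  from \<open>v\<close> to the other vertices, or Maker already has such an edge. The rest of the game is covered
  by \<open>prob_breaker_exhausts_le\<close>, conditionally on the first \<open>t\<close> moves. The probability of becoming
  dangerous is kept as a factor because it makes the sum over all \<open>v\<close> and \<open>t\<close> small.
\<close>

lemma prob_no_escape_le:
  assumes S: "breaker_strategy n a S" and T: "T \<le> card (complete_edges n)" "t \<le> T"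
    and v: "v < n" and D: "0 < D"
    and g: "real g + D + 1 + 2 * real (T div Suc a) / D \<le> real n"
  shows "measure_pmf.prob (half_random_game n a S) {h. becomes_dangerous a D h t v \<and>
      edges_between {v} ({..<n} - dangerous n a D (take t h)) \<inter> maker_edges a h = {}}
    \<le> survival (1 / real (card (complete_edges n))) a g 0 *
      measure_pmf.prob (half_random_game n a S) {h. becomes_dangerous a D h t v}"
proof -
  define N where "N = card (complete_edges n)"
  define c where "c = survival (1 / real N) a g 0"
  define Z where "Z p = edges_between {v} ({..<n} - dangerous n a D p)" for p
  let ?A = "{h. becomes_dangerous a D h t v \<and> Z (take t h) \<inter> maker_edges a h = {}}"
  have t: "t \<le> N" using T by (simp add: N_def)
  have becomes: "becomes_dangerous a D h t v \<longleftrightarrow> becomes_dangerous a D (take t h) t v" for h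
    by (simp add: becomes_dangerous_def min_def)
  have *: "emeasure (play_on n a S p (N - t)) ?A \<le> ennreal c * indicator {p. becomes_dangerous a D p t v} p"
    if pp: "p \<in> set_pmf (half_random_play n a S t)" for p
  proof -
    have p: "valid_history n p" "length p = t"
      using half_random_play_support[OF S _ pp] t by (auto simp: N_def)
    have supp: "take t h = p" if "h \<in> set_pmf (play_on n a S p (N - t))" for h
      using play_on_support[OF S p(1) _ that] p(2) t by (simp add: N_def)
    show ?thesis
    proof (cases "becomes_dangerous a D p t v \<and> Z p \<inter> maker_edges a p = {}")
      case False
      have "measure_pmf.prob (play_on n a S p (N - t)) ?A = 0"
      proof (subst measure_pmf_zero_iff)
        show "set_pmf (play_on n a S p (N - t)) \<inter> ?A = {}"
        proof (rule ccontr)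
          assume "set_pmf (play_on n a S p (N - t)) \<inter> ?A \<noteq> {}"
          then obtain h where "take t h = p" "becomes_dangerous a D h t v" "Z (take t h) \<inter> maker_edges a h = {}"
            using supp by blast
          then show False using False becomes[of h] maker_edges_mono[of a t h] by auto
        qed
      qed
      then show ?thesis by (simp add: measure_pmf.emeasure_eq_measure)
    next
      case True
      \<comment> \<open>one move earlier \<open>v\<close> was not dangerous, and a move adds at most one to its degree\<close>
      then have bd: "real (breaker_degree a (take (t - 1) p) v) < D" "D \<le> real (breaker_degree a p v)"
        using p(2) by (auto simp: becomes_dangerous_def)
      have "t \<noteq> 0" using bd p(2) by (intro notI) simp
      then have "p = take (t - 1) p @ [p ! (t - 1)]"
        using p(2) take_Suc_conv_app_nth[of "t - 1" p] by simp
      then have "breaker_edges a p \<subseteq> insert (p ! (t - 1)) (breaker_edges a (take (t - 1) p))"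
        using breaker_edges_append[of a "take (t - 1) p" "p ! (t - 1)"] by (auto split: if_splits)
      then have "breaker_degree a p v \<le>
          card (insert (p ! (t - 1)) {e \<in> breaker_edges a (take (t - 1) p). v \<in> e})"
        unfolding breaker_degree_def by (intro card_mono) auto
      also have "\<dots> \<le> Suc (breaker_degree a (take (t - 1) p) v)"
        unfolding breaker_degree_def by (rule card_insert_le_m1) auto
      finally have deg: "real (breaker_degree a p v) \<le> D + 1" using bd by linarith
      have vd: "v \<in> dangerous n a D p" using bd v by (simp add: dangerous_def)
      have "2 * real (t div Suc a) / D \<le> 2 * real (T div Suc a) / D"
        using D T(2) by (intro divide_right_mono mult_left_mono) (auto intro: div_le_mono)
      then have dang: "real (card (dangerous n a D p)) \<le> 2 * real (T div Suc a) / D"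
        using card_dangerous_le[OF p(1) D, of a] unfolding p(2) by (rule order_trans[rotated])
      have Zsub: "Z p \<subseteq> complete_edges n"
        unfolding Z_def using v vd by (intro edges_between_subset) auto
      have "card (Z p) = card ({..<n} - dangerous n a D p)"
        unfolding Z_def using vd by (subst card_edges_between) auto
      also have "\<dots> = n - card (dangerous n a D p)"
        by (subst card_Diff_subset) (auto simp: dangerous_def)
      finally have cardZ: "real n - real (card (dangerous n a D p)) \<le> real (card (Z p))" by linarith
      have finZ: "finite (Z p)" using Zsub by (rule finite_subset) simp
      have "Z p \<subseteq> (Z p \<inter> free_edges n p) \<union> {e \<in> breaker_edges a p. v \<in> e}"
        using True Zsub by (auto simp: free_edges_eq[of n p a] Z_def elim: edges_betweenE)
      then have "card (Z p) \<le> card ((Z p \<inter> free_edges n p) \<union> {e \<in> breaker_edges a p. v \<in> e})"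
        using finZ by (intro card_mono) auto
      also have "\<dots> \<le> card (Z p \<inter> free_edges n p) + breaker_degree a p v"
        unfolding breaker_degree_def by (rule card_Un_le)
      finally have "g \<le> card (Z p \<inter> free_edges n p)" using cardZ deg dang g by linarith
      then have "measure_pmf.prob (play_on n a S p (N - t)) {h. Z p \<inter> maker_edges a h = {}} \<le> c"
        using prob_breaker_exhausts_le[OF S p(1) Zsub] p(2) by (simp add: c_def N_def)
      then have "emeasure (play_on n a S p (N - t)) {h. Z p \<inter> maker_edges a h = {}} \<le> ennreal c"
        by (simp add: measure_pmf.emeasure_eq_measure ennreal_leI)
      moreover have "emeasure (play_on n a S p (N - t)) ?A \<le>
          emeasure (play_on n a S p (N - t)) {h. Z p \<inter> maker_edges a h = {}}"
        by (intro emeasure_mono_AE) (auto simp: AE_measure_pmf_iff dest: supp)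
      ultimately show ?thesis using True by simp
    qed
  qed
  have gN: "real g * (1 / real N) \<le> 1"
  proof -
    have "0 \<le> 2 * real (T div Suc a) / D" using D by simp
    then have g1: "real g \<le> real n - 1" using g D by linarith
    have "real g \<le> real N"
    proof (cases "n \<ge> 2")
      case True
      have "(real n - 1) * 2 \<le> (real n - 1) * real n"
        using True by (intro mult_left_mono) auto
      then show ?thesis
        using g1 unfolding N_def real_card_complete_edges by (simp add: mult.commute)
    next
      case False
      then have "g = 0" using g1 by linarith
      then show ?thesis by simp
    qed
    then show ?thesis by (auto simp: divide_le_eq)
  qed
  have c: "0 \<le> c" unfolding c_def by (rule survival_nonneg[OF _ gN]) simp
  have "emeasure (half_random_game n a S) ?A =
      (\<integral>\<^sup>+p. emeasure (play_on n a S p (N - t)) ?A \<partial>half_random_play n a S t)"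
    using t by (simp add: half_random_game_split N_def)
  also have "\<dots> \<le> (\<integral>\<^sup>+p. ennreal c * indicator {p. becomes_dangerous a D p t v} p \<partial>half_random_play n a S t)"
    by (intro nn_integral_mono_AE) (simp only: AE_measure_pmf_iff, intro ballI *)
  also have "\<dots> = ennreal c * emeasure (half_random_play n a S t) {p. becomes_dangerous a D p t v}"
    by (subst nn_integral_cmult) simp_all
  also have "emeasure (half_random_play n a S t) {p. becomes_dangerous a D p t v} =
      emeasure (half_random_game n a S) {h. becomes_dangerous a D h t v}"
    using prob_half_random_game_take[OF S, of t "\<lambda>p. becomes_dangerous a D p t v"] t
    unfolding measure_pmf.emeasure_eq_measure by (subst (2) becomes) (simp add: N_def)
  finally show ?thesis using c
    by (simp add: measure_pmf.emeasure_eq_measure c_def N_def Z_def flip: ennreal_mult)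
qed

text \<open>
  A vertex becomes dangerous at most once, so the left-hand side is the expected number of vertices
  that are dangerous after \<open>T\<close> moves.
\<close>

lemma sum_prob_becomes_dangerous_le:
  assumes S: "breaker_strategy n a S" and T: "T \<le> card (complete_edges n)" and D: "0 < D"
  shows "(\<Sum>(v, t)\<in>{..<n} \<times> {..T}. measure_pmf.prob (half_random_game n a S) {h. becomes_dangerous a D h t v})
    \<le> 2 * real (T div Suc a) / D"
  unfolding case_prod_beta
proof (rule sum_prob_le_bound)
  fix h assume "h \<in> set_pmf (half_random_game n a S)"
  then have h: "valid_history n h" "length h = card (complete_edges n)"
    using half_random_play_support[OF S order_refl] by (auto simp: half_random_game_def)
  let ?X = "{i \<in> {..<n} \<times> {..T}. becomes_dangerous a D h (snd i) (fst i)}"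
  have not_less: "\<not> s < t"
    if "becomes_dangerous a D h s v" "becomes_dangerous a D h t v" for s t v
  proof
    assume "s < t"
    then have "breaker_degree a (take s h) v \<le> breaker_degree a (take (t - 1) h) v"
      by (intro breaker_degree_mono) simp
    then show False using that by (simp add: becomes_dangerous_def)
  qed
  have "card ?X \<le> card (dangerous n a D (take T h))"
  proof (rule card_inj_on_le[where f = fst])
    show "inj_on fst ?X"
    proof (rule inj_onI)
      fix i j assume i: "i \<in> ?X" and j: "j \<in> ?X" and eq: "fst i = fst j"
      have "\<not> snd i < snd j" by (rule not_less[where v = "fst i"]) (use i j eq in simp_all)
      moreover have "\<not> snd j < snd i" by (rule not_less[where v = "fst i"]) (use i j eq in simp_all)
      ultimately show "i = j" using eq by (simp add: prod_eq_iff)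
    qed
    show "fst ` ?X \<subseteq> dangerous n a D (take T h)"
    proof
      fix v assume "v \<in> fst ` ?X"
      then obtain t where "v < n" "t \<le> T" "becomes_dangerous a D h t v" by auto
      then show "v \<in> dangerous n a D (take T h)"
        using breaker_degree_mono[of t T a h v] by (auto simp: becomes_dangerous_def dangerous_def)
    qed
  qed simp
  also have "real \<dots> \<le> 2 * real (T div Suc a) / D"
  proof -
    have "valid_history n (take T h)"
      using h set_take_subset[of T h] by (auto simp: valid_history_def)
    then have "real (card (dangerous n a D (take T h))) \<le> 2 * real (length (take T h) div Suc a) / D"
      by (rule card_dangerous_le) (rule D)
    moreover have "length (take T h) = T" using h T by simp
    ultimately show ?thesis by simp
  qed
  finally show "real (card ?X) \<le> 2 * real (T div Suc a) / D" by simp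
qed simp


lemma power_one_minus_density_le:
  assumes z: "0 \<le> z" "z \<le> real (card (complete_edges n))" and n: "0 < n"
  shows "(1 - z / real (card (complete_edges n)) / 2) ^ m \<le> exp (- (z * real m / (real n)\<^sup>2))"
proof (cases "z = 0")
  case False
  define N where "N = real (card (complete_edges n))"
  define y where "y = z / N / 2"
  have N: "0 < N" using z False by (simp add: N_def)
  have "z / N \<le> 1" using z N by (simp add: N_def)
  then have y: "y \<le> 1" by (simp add: y_def)
  have "2 * N \<le> (real n)\<^sup>2"
    unfolding N_def real_card_complete_edges by (simp add: power2_eq_square algebra_simps)
  then have "z / (real n)\<^sup>2 \<le> z / (2 * N)"
    using z N by (intro divide_left_mono mult_pos_pos) (use n in auto)
  also have "\<dots> = y" by (simp add: y_def)
  finally have zy: "z / (real n)\<^sup>2 \<le> y" .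
  have "(1 - y) ^ m \<le> exp (- y) ^ m"
    using y exp_ge_add_one_self[of "- y"] by (intro power_mono) auto
  also have "\<dots> = exp (- (y * real m))" by (simp add: exp_of_nat_mult[symmetric] mult.commute)
  also have "\<dots> \<le> exp (- (z / (real n)\<^sup>2 * real m))"
    using mult_right_mono[OF zy, of "real m"] by simp
  finally show ?thesis by (simp add: y_def N_def)
qed simp

text \<open>
  The game is now observed for \<open>R\<close> full rounds. The error bounds for cuts and for degrees are powers
  of the same quantity \<open>x\<close>: Maker has no edge in the cut around a large set of \<open>k\<close> vertices with
  probability at most \<open>2 * x ^ k\<close>.
\<close>

context
  fixes n a R K :: nat and S :: strategy and D x :: real
  assumes S: "breaker_strategy n a S"
    and T: "R * Suc a \<le> card (complete_edges n)"
    and n: "0 < n"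
  defines "x \<equiv> exp (- (real (a * R) / (4 * real n)))"
begin

lemma maker_moves_in_rounds: "R * Suc a - R * Suc a div Suc a = a * R"
  by (simp add: diff_mult_distrib2 del: mult_Suc_right) simp

lemma breaker_edges_in_rounds: "length h = R * Suc a \<Longrightarrow> card (breaker_edges a h) \<le> R"
  using card_breaker_edges_le[of a h] by (simp del: mult_Suc_right)

text \<open>
  A cut with \<open>k \<le> n / 2\<close> vertices on one side has at least \<open>k n / 2\<close> edges. If \<open>4 (R + 1) \<le> k n\<close>,
  Breaker's \<open>R\<close> edges leave \<open>k n / 4\<close> of them free, however he plays.
\<close>

lemma prob_uncut_le:
  assumes C: "C \<subseteq> {..<n}" "2 * card C \<le> n" and K: "4 * (R + 1) \<le> card C * n"
  shows "measure_pmf.prob (half_random_play n a S (R * Suc a))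
    {h. edges_between C ({..<n} - C) \<inter> maker_edges a h = {}} \<le> 2 * x ^ card C"
proof -
  define Z where "Z = edges_between C ({..<n} - C)"
  define N where "N = real (card (complete_edges n))"
  define k where "k = card C"
  define z where "z = real k * real n / 4"
  have finC: "finite C" using C(1) by (rule finite_subset) simp
  have Z: "Z \<subseteq> complete_edges n" unfolding Z_def using C by (intro edges_between_subset) auto
  have "card Z = k * (n - k)"
    unfolding Z_def k_def using C finC by (simp add: card_edges_between card_Diff_subset)
  moreover have "k \<le> n" using C by (simp add: k_def)
  ultimately have "real (card Z) = real k * (real n - real k)" by (simp add: of_nat_diff)
  moreover have "real k * (real n / 2) \<le> real k * (real n - real k)"
    using C(2) by (intro mult_left_mono) (auto simp: k_def)
  ultimately have cardZ: "2 * z \<le> real (card Z)" by (simp add: z_def)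
  have "real (4 * (R + 1)) \<le> real (card C * n)" using K by (rule of_nat_mono)
  then have Rz: "real R + 1 \<le> z" by (simp add: z_def k_def)
  have z0: "0 \<le> z" by (simp add: z_def)
  have "real (card Z) \<le> N" unfolding N_def using Z by (simp add: card_mono)
  then have zN: "z \<le> N" using cardZ z0 by linarith
  have "measure_pmf.prob (half_random_play n a S (R * Suc a)) {h. Z \<inter> maker_edges a h = {}}
    \<le> measure_pmf.prob (half_random_play n a S (R * Suc a))
      {h. card (Z \<inter> maker_edges a h) < 1 \<and>
          z + real 1 + real (card (Z \<inter> breaker_edges a h)) \<le> real (card Z)}"
  proof (rule measure_pmf.finite_measure_mono_AE)
    have "z + 1 + real (card (Z \<inter> breaker_edges a h)) \<le> real (card Z)"
      if "h \<in> set_pmf (half_random_play n a S (R * Suc a))" for h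
    proof -
      have "card (Z \<inter> breaker_edges a h) \<le> card (breaker_edges a h)" by (intro card_mono) auto
      also have "\<dots> \<le> R"
        using half_random_play_support[OF S T that] by (intro breaker_edges_in_rounds) simp
      finally show ?thesis using cardZ Rz by linarith
    qed
    then show "AE h in measure_pmf (half_random_play n a S (R * Suc a)).
        h \<in> {h. Z \<inter> maker_edges a h = {}} \<longrightarrow> h \<in> {h. card (Z \<inter> maker_edges a h) < 1 \<and>
          z + real 1 + real (card (Z \<inter> breaker_edges a h)) \<le> real (card Z)}"
      by (simp add: AE_measure_pmf_iff)
  qed simp
  also have "\<dots> \<le> 2 ^ 1 * (1 - z / N / 2) ^ (a * R)"
    using prob_few_maker_edges_le[OF S Z z0 _ T, of 1] zN
    unfolding maker_moves_in_rounds N_def by simp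
  also have "\<dots> \<le> 2 * exp (- (z * real (a * R) / (real n)\<^sup>2))"
    using power_one_minus_density_le[OF z0 _ n, of "a * R"] zN by (simp add: N_def)
  also have "z * real (a * R) / (real n)\<^sup>2 = real k * (real (a * R) / (4 * real n))"
    using n by (simp add: z_def power2_eq_square)
  also have "exp (- (real k * (real (a * R) / (4 * real n)))) = x ^ card C"
    by (simp add: x_def k_def exp_of_nat_mult[symmetric])
  finally show ?thesis by (simp add: Z_def)
qed

text \<open>
  As long as Breaker has fewer than \<open>D\<close> edges at \<open>w\<close> and Maker fewer than \<open>K\<close>, at least \<open>n / 2\<close> edges
  at \<open>w\<close> are free.
\<close>

lemma prob_low_degree_le:
  assumes w: "w < n" and D: "real n / 2 + real K + D \<le> real n - 1" "0 < D"
  shows "measure_pmf.prob (half_random_play n a S (R * Suc a))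
    {h. real (breaker_degree a h w) < D \<and>
        card (edges_between {w} ({..<n} - {w}) \<inter> maker_edges a h) < K} \<le> 2 ^ K * x\<^sup>2"
proof -
  define Z where "Z = edges_between {w} ({..<n} - {w})"
  define N where "N = real (card (complete_edges n))"
  define z where "z = real n / 2"
  have Z: "Z \<subseteq> complete_edges n" unfolding Z_def using w by (intro edges_between_subset) auto
  have cardZ: "real (card Z) = real n - 1"
    unfolding Z_def using w by (simp add: card_edges_between of_nat_diff)
  have z0: "0 \<le> z" by (simp add: z_def)
  have "real (card Z) \<le> N" unfolding N_def using Z by (simp add: card_mono)
  then have zN: "z \<le> N" using cardZ D by (simp add: z_def)
  have "measure_pmf.prob (half_random_play n a S (R * Suc a))
      {h. real (breaker_degree a h w) < D \<and> card (Z \<inter> maker_edges a h) < K}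
    \<le> measure_pmf.prob (half_random_play n a S (R * Suc a))
      {h. card (Z \<inter> maker_edges a h) < K \<and>
          z + real K + real (card (Z \<inter> breaker_edges a h)) \<le> real (card Z)}"
  proof (rule measure_pmf.finite_measure_mono)
    have "card (Z \<inter> breaker_edges a h) \<le> breaker_degree a h w" for h
      unfolding breaker_degree_def Z_def
      by (intro card_mono) (auto elim: edges_betweenE)
    then have "z + real K + real (card (Z \<inter> breaker_edges a h)) \<le> real (card Z)"
      if "real (breaker_degree a h w) < D" for h
      using that D cardZ unfolding z_def by (smt (verit) of_nat_mono)
    then show "{h. real (breaker_degree a h w) < D \<and> card (Z \<inter> maker_edges a h) < K} \<subseteq>
      {h. card (Z \<inter> maker_edges a h) < K \<and>
          z + real K + real (card (Z \<inter> breaker_edges a h)) \<le> real (card Z)}" by blast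
  qed simp
  also have "\<dots> \<le> 2 ^ K * (1 - z / N / 2) ^ (a * R)"
    using prob_few_maker_edges_le[OF S Z z0 _ T, of K] zN
    unfolding maker_moves_in_rounds N_def by simp
  also have "\<dots> \<le> 2 ^ K * exp (- (z * real (a * R) / (real n)\<^sup>2))"
    using power_one_minus_density_le[OF z0 _ n, of "a * R"] zN by (simp add: N_def)
  also have "z * real (a * R) / (real n)\<^sup>2 = real 2 * (real (a * R) / (4 * real n))"
    using n by (simp add: z_def power2_eq_square)
  also have "exp (- (real 2 * (real (a * R) / (4 * real n)))) = x ^ 2"
    unfolding x_def by (subst exp_of_nat_mult[symmetric]) simp
  finally show ?thesis by (simp add: Z_def)
qed

text \<open>
  The three summands are the failure probabilities of the three conditions of
  \<open>connected_graph_if_dangerous_escape\<close>, each obtained by a union bound: over all nonempty vertex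
  sets, over all vertices, and over all pairs of a vertex and a time at which it may become
  dangerous.
\<close>

lemma prob_disconnected_le:
  assumes D: "real n / 2 + real K + D \<le> real n - 1" "0 < D"
    and K: "4 * (R + 1) \<le> K * n"
    and g: "real g + D + 1 + 2 * real R / D \<le> real n"
  shows "measure_pmf.prob (half_random_game n a S) {h. \<not> connected_graph n (maker_edges a h)}
    \<le> 2 * ((1 + x) ^ n - 1) + real n * (2 ^ K * x\<^sup>2)
      + survival (1 / real (card (complete_edges n))) a g 0 * (2 * real R / D)"
proof -
  define T where "T = R * Suc a"
  define G where "G = half_random_game n a S"
  define c where "c = survival (1 / real (card (complete_edges n))) a g 0"
  have TR: "T div Suc a = R" by (simp add: T_def del: mult_Suc_right)
  have TN: "T \<le> card (complete_edges n)" using T by (simp add: T_def)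
  define \<C> where "\<C> = {C \<in> Pow {..<n}. K \<le> card C \<and> 2 * card C \<le> n \<and> C \<noteq> {}}"
  define B1 where "B1 h C \<longleftrightarrow> edges_between C ({..<n} - C) \<inter> maker_edges a (take T h) = {}" for h C
  define B2 where "B2 h w \<longleftrightarrow> real (breaker_degree a (take T h) w) < D \<and>
        card (edges_between {w} ({..<n} - {w}) \<inter> maker_edges a (take T h)) < K" for h w
  define B3 where "B3 h i \<longleftrightarrow> becomes_dangerous a D h (snd i) (fst i) \<and>
      edges_between {fst i} ({..<n} - dangerous n a D (take (snd i) h)) \<inter> maker_edges a h = {}" for h and i :: "nat \<times> nat"
  have fin\<C>: "finite \<C>" by (simp add: \<C>_def)
  have "measure_pmf.prob G {h. \<not> connected_graph n (maker_edges a h)}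
    \<le> measure_pmf.prob G ({h. \<exists>C\<in>\<C>. B1 h C} \<union> {h. \<exists>w\<in>{..<n}. B2 h w} \<union> {h. \<exists>i\<in>{..<n}\<times>{..T}. B3 h i})"
  proof (rule measure_pmf.finite_measure_mono)
    show "{h. \<not> connected_graph n (maker_edges a h)} \<subseteq>
        {h. \<exists>C\<in>\<C>. B1 h C} \<union> {h. \<exists>w\<in>{..<n}. B2 h w} \<union> {h. \<exists>i\<in>{..<n}\<times>{..T}. B3 h i}"
    proof (rule subsetI, rule ccontr)
      fix h assume h: "h \<in> {h. \<not> connected_graph n (maker_edges a h)}"
        and not: "h \<notin> {h. \<exists>C\<in>\<C>. B1 h C} \<union> {h. \<exists>w\<in>{..<n}. B2 h w} \<union> {h. \<exists>i\<in>{..<n}\<times>{..T}. B3 h i}"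
      have "connected_graph n (maker_edges a h)"
      proof (rule connected_graph_if_dangerous_escape[OF D(2), where K = K and T = T])
        fix C assume "C \<subseteq> {..<n}" "K \<le> card C" "2 * card C \<le> n" "C \<noteq> {}"
        then have "C \<in> \<C>" by (simp add: \<C>_def)
        then show "edges_between C ({..<n} - C) \<inter> maker_edges a (take T h) \<noteq> {}"
          using not by (auto simp: B1_def)
      next
        fix w assume "w < n" "real (breaker_degree a (take T h) w) < D"
        moreover have "\<not> B2 h w" using not \<open>w < n\<close> by blast
        ultimately show "K \<le> card (edges_between {w} ({..<n} - {w}) \<inter> maker_edges a (take T h))"
          by (simp add: B2_def)
      next
        fix v t assume "v < n" "t \<le> T" "becomes_dangerous a D h t v"
        moreover have "\<not> B3 h (v, t)" using not \<open>v < n\<close> \<open>t \<le> T\<close> by blast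
        ultimately show "edges_between {v} ({..<n} - dangerous n a D (take t h)) \<inter> maker_edges a h \<noteq> {}"
          by (simp add: B3_def)
      qed
      then show False using h by simp
    qed
  qed simp
  also have "\<dots> \<le> measure_pmf.prob G {h. \<exists>C\<in>\<C>. B1 h C} + measure_pmf.prob G {h. \<exists>w\<in>{..<n}. B2 h w}
      + measure_pmf.prob G {h. \<exists>i\<in>{..<n}\<times>{..T}. B3 h i}"
    by (intro order_trans[OF measure_Un_le] add_mono measure_Un_le) auto
  also have "measure_pmf.prob G {h. \<exists>C\<in>\<C>. B1 h C} \<le> 2 * ((1 + x) ^ n - 1)"
  proof -
    have "measure_pmf.prob G {h. \<exists>C\<in>\<C>. B1 h C} \<le> (\<Sum>C\<in>\<C>. measure_pmf.prob G {h. B1 h C})"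
      by (rule prob_bex_le[OF fin\<C>])
    also have "\<dots> \<le> (\<Sum>C\<in>\<C>. 2 * x ^ card C)"
    proof (rule sum_mono)
      fix C assume C: "C \<in> \<C>"
      then have "K * n \<le> card C * n" by (simp add: \<C>_def)
      then have "4 * (R + 1) \<le> card C * n" using K by linarith
      then show "measure_pmf.prob G {h. B1 h C} \<le> 2 * x ^ card C"
        using prob_uncut_le[of C] C
          prob_half_random_game_take[OF S TN, of "\<lambda>h. edges_between C ({..<n} - C) \<inter> maker_edges a h = {}"]
        by (simp add: \<C>_def B1_def G_def T_def del: mult_Suc_right)
    qed
    also have "\<dots> \<le> (\<Sum>C\<in>Pow {..<n} - {{}}. 2 * x ^ card C)"
      by (rule sum_mono2) (auto simp: \<C>_def x_def)
    also have "\<dots> = 2 * ((\<Sum>C\<in>Pow {..<n}. x ^ card C) - 1)"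
      by (simp add: sum_diff1 flip: sum_distrib_left)
    also have "(\<Sum>C\<in>Pow {..<n}. x ^ card C) = (1 + x) ^ n"
      by (simp add: sum_power_card_Pow)
    finally show ?thesis .
  qed
  also have "measure_pmf.prob G {h. \<exists>w\<in>{..<n}. B2 h w} \<le> real n * (2 ^ K * x\<^sup>2)"
  proof -
    have "measure_pmf.prob G {h. \<exists>w\<in>{..<n}. B2 h w} \<le> (\<Sum>w<n. measure_pmf.prob G {h. B2 h w})"
      by (rule prob_bex_le) simp
    also have "\<dots> \<le> (\<Sum>w<n. 2 ^ K * x\<^sup>2)"
    proof (rule sum_mono)
      fix w assume "w \<in> {..<n}"
      then show "measure_pmf.prob G {h. B2 h w} \<le> 2 ^ K * x\<^sup>2"
        using prob_low_degree_le[OF _ D, of w]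
          prob_half_random_game_take[OF S TN, of "\<lambda>h. real (breaker_degree a h w) < D \<and>
        card (edges_between {w} ({..<n} - {w}) \<inter> maker_edges a h) < K"]
        by (simp add: B2_def G_def T_def del: mult_Suc_right)
    qed
    finally show ?thesis by simp
  qed
  also have "measure_pmf.prob G {h. \<exists>i\<in>{..<n}\<times>{..T}. B3 h i} \<le> c * (2 * real R / D)"
  proof -
    have c: "0 \<le> c"
    proof -
      have "0 \<le> 2 * real R / D" using D by simp
      then have "real g \<le> real n - 1" using g D by linarith
      also have "\<dots> \<le> real (card (complete_edges n))"
      proof (cases "n = 1")
        case False
        then have "(real n - 1) * 2 \<le> (real n - 1) * real n" using n by (intro mult_left_mono) auto
        then show ?thesis unfolding real_card_complete_edges by (simp add: mult.commute)
      qed simp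
      finally show ?thesis unfolding c_def by (intro survival_nonneg) (auto simp: divide_le_eq)
    qed
    have "measure_pmf.prob G {h. \<exists>i\<in>{..<n}\<times>{..T}. B3 h i} \<le> (\<Sum>i\<in>{..<n}\<times>{..T}. measure_pmf.prob G {h. B3 h i})"
      by (rule prob_bex_le) simp
    also have "\<dots> \<le> (\<Sum>i\<in>{..<n}\<times>{..T}. c * measure_pmf.prob G {h. becomes_dangerous a D h (snd i) (fst i)})"
    proof (rule sum_mono)
      fix i assume "i \<in> {..<n}\<times>{..T}"
      then have i: "snd i \<le> T" "fst i < n" by auto
      show "measure_pmf.prob G {h. B3 h i} \<le> c * measure_pmf.prob G {h. becomes_dangerous a D h (snd i) (fst i)}"
        unfolding B3_def G_def c_def
        by (rule prob_no_escape_le[OF S TN i D(2)]) (use g TR in simp)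
    qed
    also have "\<dots> \<le> c * (2 * real R / D)"
      using sum_prob_becomes_dangerous_le[OF S TN D(2)] c
      unfolding TR case_prod_beta G_def sum_distrib_left[symmetric] by (rule mult_left_mono)
    finally show ?thesis .
  qed
  finally show ?thesis by (simp add: G_def c_def)
qed

end


section \<open>Maker wins above the threshold\<close>

lemma rounding_of_bounds:
  assumes "rounding_of a x"
  shows "x n - 1 \<le> real (a n)" "real (a n) \<le> max 0 (x n) + 1"
proof -
  have "a n = nat \<lfloor>x n\<rfloor> \<or> a n = nat \<lceil>x n\<rceil>" using assms by (auto simp: rounding_of_def)
  then show "x n - 1 \<le> real (a n)" "real (a n) \<le> max 0 (x n) + 1" by linarith+
qed

lemma survival_le_exp:
  assumes "0 \<le> q" "real g * q \<le> 1"
  shows "survival q a g 0 \<le> exp (- (real a * q * (real g * (real g - 1) / 2)))"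
proof -
  have sum: "(\<Sum>i<g. real i) = real g * (real g - 1) / 2"
    by (induction g) (simp_all add: field_simps)
  have "survival q a g 0 = (\<Prod>i<g. (1 - real i * q) ^ a)" by (simp add: survival_def)
  also have "\<dots> \<le> (\<Prod>i<g. exp (- (real a * q * real i)))"
  proof (rule prod_mono, intro conjI)
    fix i assume "i \<in> {..<g}"
    then have i: "0 \<le> 1 - real i * q" using survival_factor[OF assms, of i] by simp
    then show "0 \<le> (1 - real i * q) ^ a" by simp
    have "(1 - real i * q) ^ a \<le> exp (- (real i * q)) ^ a"
      using i exp_ge_add_one_self[of "- (real i * q)"] by (intro power_mono) auto
    also have "\<dots> = exp (real a * - (real i * q))" by (simp only: exp_of_nat_mult)
    also have "real a * - (real i * q) = - (real a * q * real i)" by simp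
    finally show "(1 - real i * q) ^ a \<le> exp (- (real a * q * real i))" .
  qed
  also have "\<dots> = exp (\<Sum>i<g. - (real a * q * real i))" by (simp add: exp_sum)
  also have "(\<Sum>i<g. - (real a * q * real i)) = - (real a * q * (real g * (real g - 1) / 2))"
    unfolding sum[symmetric] by (simp add: sum_negf sum_distrib_left)
  finally show ?thesis .
qed

text \<open>
  The bound of \<open>prob_disconnected_le\<close>, summand by summand, for the parameters chosen in
  \<open>prob_disconnected_le_disconnection_bound\<close>, in terms of \<open>n\<close>, \<open>\<delta>\<close> and \<open>\<epsilon>\<close> alone. The last summand is where the
  threshold enters: at most of the order of \<open>ln n\<close> vertices become dangerous, and each of them fails
  to escape with probability at most \<open>(ln n) powr - (1 + \<epsilon> / 4)\<close>.
\<close>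

definition disconnection_bound :: "real \<Rightarrow> real \<Rightarrow> real \<Rightarrow> real" where
  "disconnection_bound \<delta> \<epsilon> n =
     2 * (exp (n * exp (- 3 * ln n)) - 1) + n * (exp (ln n + 9) * exp (- 6 * ln n))
       + exp (- (1 + \<epsilon> / 4) * ln (ln n)) * ((ln n + 2) / \<delta>)"

lemma disconnection_bound_tendsto_0:
  assumes "0 < \<epsilon>" "0 < \<delta>"
  shows "(\<lambda>n. disconnection_bound \<delta> \<epsilon> (real n)) \<longlonglongrightarrow> 0"
  unfolding disconnection_bound_def using assms by real_asymp

text \<open>
  With \<open>a R \<ge> 12 n L\<close>, the quantity \<open>x\<close> is at most \<open>n powr - 3\<close>, which beats the number of vertex sets
  of each size as well as \<open>2 ^ K\<close>; for the latter, \<open>a \<ge> 48\<close> makes \<open>K\<close>, which is about \<open>4 R / n\<close>, at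
  most \<open>L + 9\<close>. The fraction \<open>\<delta>\<close> is chosen such that
  \<open>(1 - 3 \<delta>)\<^sup>2 (1 + \<epsilon> / 2) \<ge> 1 + \<epsilon> / 4\<close>. Here \<open>2 \<delta> n\<close> edges at a vertex are given up, half of them for
  Breaker's head start and half for the other dangerous vertices, and a third \<open>\<delta> n\<close> absorbs
  rounding.
\<close>

lemma prob_disconnected_le_disconnection_bound:
  fixes n a :: nat and \<epsilon> :: real
  defines "L \<equiv> ln (real n)" and "\<delta> \<equiv> \<epsilon> / (24 + 12 * \<epsilon>)"
  assumes S: "breaker_strategy n a S" and \<epsilon>: "0 < \<epsilon>"
    and a: "48 \<le> a" "(1 + \<epsilon> / 2) * ln L \<le> real a"
    and L: "1 \<le> L"
    and n1: "24 * real n * L + real a + 1 \<le> real n * (real n - 1) / 2"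
    and n2: "1 + (L + 2) / \<delta> \<le> \<delta> * real n"
    and n3: "real n / 2 + (L + 9) + \<delta> * real n \<le> real n - 1"
    and n4: "2 \<le> \<delta> * real n"
  shows "measure_pmf.prob (half_random_game n a S) {h. \<not> connected_graph n (maker_edges a h)}
    \<le> disconnection_bound \<delta> \<epsilon> (real n)"
proof -
  have n: "0 < n"
  proof (rule Nat.gr0I)
    assume "n = 0"
    then have "L = 0" by (simp add: L_def)
    with L show False by simp
  qed
  have \<delta>: "0 < \<delta>" "\<delta> \<le> 1 / 12" using \<epsilon> by (simp_all add: \<delta>_def field_simps)
  define N where "N = real (card (complete_edges n))"
  define R where "R = nat \<lceil>12 * real n * L / real a\<rceil>"
  define P where "P = real n * L"
  have P: "real n \<le> P" using mult_left_mono[OF L, of "real n"] by (simp add: P_def)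
  define D where "D = \<delta> * real n"
  define K where "K = nat \<lceil>4 * (real R + 1) / real n\<rceil>"
  define g where "g = nat \<lfloor>(1 - 2 * \<delta>) * real n\<rfloor>"
  define x where "x = exp (- (real (a * R) / (4 * real n)))"
  have D: "0 < D" using \<delta> n by (simp add: D_def)
  have "0 \<le> 12 * real n * L / real a" using L by simp
  then have R: "12 * real n * L / real a \<le> real R" "real R \<le> 12 * real n * L / real a + 1"
    unfolding R_def by linarith+
  have "12 * real n * L / real a \<le> 12 * real n * L / 48"
    using a L by (intro divide_left_mono) auto
  also have "\<dots> = P / 4" by (simp add: P_def)
  finally have R4: "real R \<le> P / 4 + 1" using R(2) by linarith
  have aR: "12 * real n * L \<le> real (a * R)"
    using R(1) a by (simp add: divide_le_eq mult.commute)
  have aR2: "real (a * R) \<le> 12 * real n * L + real a"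
    using mult_left_mono[OF R(2), of "real a"] a by (simp add: algebra_simps)
  have T: "R * Suc a \<le> card (complete_edges n)"
  proof -
    have "real (R * Suc a) = real (a * R) + real R" by (simp add: algebra_simps)
    also have "\<dots> \<le> (12 * P + real a) + (P / 4 + 1)"
      using aR2 R4 by (intro add_mono) (simp_all add: P_def)
    also have "\<dots> \<le> 24 * P + real a + 1" using P n by linarith
    also have "\<dots> = 24 * real n * L + real a + 1" by (simp add: P_def)
    also have "\<dots> \<le> real (card (complete_edges n))" using n1 unfolding real_card_complete_edges .
    finally show ?thesis by (simp only: of_nat_le_iff)
  qed
  have "0 \<le> 4 * (real R + 1) / real n" by simp
  then have K1: "4 * (real R + 1) / real n \<le> real K" and "real K \<le> 4 * (real R + 1) / real n + 1"
    unfolding K_def by linarith+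
  moreover have "4 * (real R + 1) / real n \<le> L + 8"
  proof -
    have "4 * (real R + 1) \<le> P + 8" using R4 by (simp add: field_simps)
    also have "\<dots> \<le> (L + 8) * real n" using n by (simp add: P_def algebra_simps)
    finally show ?thesis using n by (simp add: divide_le_eq)
  qed
  ultimately have K2: "real K \<le> L + 9" by linarith
  have K3: "4 * (R + 1) \<le> K * n"
  proof -
    have "real (4 * (R + 1)) \<le> real (K * n)" using K1 n by (simp add: divide_le_eq)
    then show ?thesis by (simp only: of_nat_le_iff)
  qed
  have RD: "2 * real R / D \<le> (L + 2) / \<delta>"
  proof -
    have "2 * real R \<le> P + 2 * real n" using R4 P n by linarith
    then have "2 * real R \<le> (L + 2) * real n" by (simp add: P_def algebra_simps)
    then have "2 * real R / D \<le> (L + 2) * real n / D" using D by (intro divide_right_mono) auto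
    also have "\<dots> = (L + 2) / \<delta>" using n by (simp add: D_def)
    finally show ?thesis .
  qed
  have "0 \<le> (1 - 2 * \<delta>) * real n" using \<delta> by simp
  then have g: "real g \<le> (1 - 2 * \<delta>) * real n" "(1 - 2 * \<delta>) * real n - 1 \<le> real g"
    unfolding g_def by linarith+
  have g1: "real g + D + 1 + 2 * real R / D \<le> real n"
    using g(1) n2 RD by (simp add: D_def algebra_simps)
  have gN: "real g * (1 / N) \<le> 1"
  proof -
    have "real n \<le> 24 * real n * L" using P by (simp add: P_def)
    then have "real g \<le> N"
      using g(1) n1 \<delta> mult_right_mono[of "1 - 2 * \<delta>" 1 "real n"]
      unfolding N_def real_card_complete_edges by simp
    then show ?thesis by (auto simp: divide_le_eq)
  qed
  have bound: "measure_pmf.prob (half_random_game n a S) {h. \<not> connected_graph n (maker_edges a h)}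
    \<le> 2 * ((1 + x) ^ n - 1) + real n * (2 ^ K * x\<^sup>2) + survival (1 / N) a g 0 * (2 * real R / D)"
    unfolding x_def N_def
    by (rule prob_disconnected_le[OF S T n _ D K3 g1]) (use n3 K2 in \<open>simp add: D_def\<close>)
  have x: "0 < x" "x \<le> exp (- 3 * L)"
    using aR n by (simp_all add: x_def field_simps)
  have "(1 + x) ^ n \<le> exp x ^ n" using x exp_ge_add_one_self[of x] by (intro power_mono) auto
  also have "\<dots> = exp (real n * x)" by (simp add: exp_of_nat_mult)
  also have "\<dots> \<le> exp (real n * exp (- 3 * L))" using x by (simp add: mult_left_mono)
  finally have b1: "2 * ((1 + x) ^ n - 1) \<le> 2 * (exp (real n * exp (- 3 * L)) - 1)" by simp
  have b2: "real n * (2 ^ K * x\<^sup>2) \<le> real n * (exp (L + 9) * exp (- 6 * L))"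
  proof (intro mult_left_mono mult_mono)
    have "(2::real) ^ K \<le> exp 1 ^ K" using exp_ge_add_one_self[of 1] by (intro power_mono) auto
    also have "\<dots> = exp (real K)" by (simp flip: exp_of_nat_mult)
    also have "\<dots> \<le> exp (L + 9)" using K2 by simp
    finally show "(2::real) ^ K \<le> exp (L + 9)" .
    have "x\<^sup>2 \<le> (exp (- 3 * L))\<^sup>2" using x by (intro power_mono) auto
    also have "\<dots> = exp (- 6 * L)" by (simp flip: exp_of_nat_mult)
    finally show "x\<^sup>2 \<le> exp (- 6 * L)" .
  qed auto
  have lnL: "0 \<le> ln L" using L by simp
  have surv: "survival (1 / N) a g 0 \<le> exp (- (1 + \<epsilon> / 4) * ln L)"
  proof -
    have n2': "2 \<le> real n" using n4 \<delta> mult_right_mono[of \<delta> "1/12" "real n"] by simp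
    have N: "N = real n * (real n - 1) / 2" unfolding N_def by (rule real_card_complete_edges)
    have "(1 - 3 * \<delta>) * real n \<le> real g - 1" using g(2) n4 by (simp add: algebra_simps)
    moreover have "0 \<le> (1 - 3 * \<delta>) * real n" using \<delta> by simp
    ultimately have "((1 - 3 * \<delta>) * real n) * ((1 - 3 * \<delta>) * real n) \<le> real g * (real g - 1)"
      by (intro mult_mono) auto
    then have "(1 - 3 * \<delta>)\<^sup>2 * (real n * real n) \<le> real g * (real g - 1)"
      by (simp add: power2_eq_square mult_ac)
    moreover have "(1 - 3 * \<delta>)\<^sup>2 * (2 * N) \<le> (1 - 3 * \<delta>)\<^sup>2 * (real n * real n)"
      unfolding N by (intro mult_left_mono) (auto simp: algebra_simps)
    ultimately have "(1 - 3 * \<delta>)\<^sup>2 * (2 * N) \<le> real g * (real g - 1)" by linarith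
    moreover have "0 < N" using n2' by (simp add: N)
    ultimately have gg: "(1 - 3 * \<delta>)\<^sup>2 \<le> 1 / N * (real g * (real g - 1) / 2)"
      by (simp add: field_simps)
    have "1 + \<epsilon> / 4 \<le> (1 - 6 * \<delta>) * (1 + \<epsilon> / 2)"
      using \<epsilon> by (simp add: \<delta>_def divide_simps) (simp add: algebra_simps)
    also have "\<dots> \<le> (1 - 3 * \<delta>)\<^sup>2 * (1 + \<epsilon> / 2)"
      using \<epsilon> by (intro mult_right_mono) (auto simp: power2_eq_square algebra_simps)
    finally have "(1 + \<epsilon> / 4) * ln L \<le> (1 - 3 * \<delta>)\<^sup>2 * (1 + \<epsilon> / 2) * ln L"
      using lnL by (rule mult_right_mono)
    also have "\<dots> = (1 - 3 * \<delta>)\<^sup>2 * ((1 + \<epsilon> / 2) * ln L)" by simp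
    also have "\<dots> \<le> (1 - 3 * \<delta>)\<^sup>2 * real a" using a(2) by (rule mult_left_mono) simp
    also have "\<dots> \<le> (1 / N * (real g * (real g - 1) / 2)) * real a"
      using gg by (rule mult_right_mono) simp
    also have "\<dots> = real a * (1 / N) * (real g * (real g - 1) / 2)" by simp
    finally have "exp (- (real a * (1 / N) * (real g * (real g - 1) / 2))) \<le> exp (- (1 + \<epsilon> / 4) * ln L)"
      by (simp only: exp_le_cancel_iff mult_minus_left neg_le_iff_le)
    moreover have "survival (1 / N) a g 0 \<le> exp (- (real a * (1 / N) * (real g * (real g - 1) / 2)))"
      using gN by (intro survival_le_exp) (auto simp: N_def)
    ultimately show ?thesis by linarith
  qed
  have b3: "survival (1 / N) a g 0 * (2 * real R / D) \<le> exp (- (1 + \<epsilon> / 4) * ln L) * ((L + 2) / \<delta>)"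
    using surv RD D by (intro mult_mono) auto
  show ?thesis using bound b1 b2 b3 unfolding disconnection_bound_def L_def by linarith
qed

lemma maker_wins_above_threshold:
  assumes \<epsilon>: "0 < \<epsilon>" and a: "rounding_of a (\<lambda>n. (1 + \<epsilon>) * ln (ln (real n)))"
    and S: "\<And>n. breaker_strategy n (a n) (S n)"
  shows "maker_wins_aas connected_graph a S"
proof -
  define \<delta> where "\<delta> = \<epsilon> / (24 + 12 * \<epsilon>)"
  have \<delta>: "0 < \<delta>" "\<delta> \<le> 1 / 12" using \<epsilon> by (simp_all add: \<delta>_def field_simps)
  define p where "p n = measure_pmf.prob (half_random_game n (a n) (S n))
      {h. connected_graph n (maker_edges (a n) h)}" for n
  have "\<forall>\<^sub>F n in sequentially. 49 \<le> (1 + \<epsilon>) * ln (ln (real n))"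
    "\<forall>\<^sub>F n in sequentially. (1 + \<epsilon> / 2) * ln (ln (real n)) \<le> (1 + \<epsilon>) * ln (ln (real n)) - 1"
    "\<forall>\<^sub>F n in sequentially. 1 \<le> ln (real n)"
    "\<forall>\<^sub>F n in sequentially. 24 * real n * ln (real n) + ((1 + \<epsilon>) * ln (ln (real n)) + 1) + 1
       \<le> real n * (real n - 1) / 2"
    "\<forall>\<^sub>F n in sequentially. 1 + (ln (real n) + 2) / \<delta> \<le> \<delta> * real n"
    "\<forall>\<^sub>F n in sequentially. real n / 2 + (ln (real n) + 9) + 1 / 12 * real n \<le> real n - 1"
    "\<forall>\<^sub>F n in sequentially. 2 \<le> \<delta> * real n"
    using \<epsilon> \<delta>(1) by real_asymp+
  then have "\<forall>\<^sub>F n in sequentially. 1 - disconnection_bound \<delta> \<epsilon> (real n) \<le> p n"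
  proof eventually_elim
    case (elim n)
    note ab = rounding_of_bounds[OF a, of n]
    have "1 - p n = measure_pmf.prob (half_random_game n (a n) (S n))
        {h. \<not> connected_graph n (maker_edges (a n) h)}"
      unfolding p_def by (subst measure_pmf.prob_compl[symmetric]) (auto intro: arg_cong2[where f = measure])
    also have "\<dots> \<le> disconnection_bound \<delta> \<epsilon> (real n)"
      unfolding \<delta>_def
    proof (rule prob_disconnected_le_disconnection_bound[OF S \<epsilon>], unfold \<delta>_def[symmetric])
      show "48 \<le> a n" using ab elim by linarith
      show "real n / 2 + (ln (real n) + 9) + \<delta> * real n \<le> real n - 1"
        using elim mult_right_mono[OF \<delta>(2), of "real n"] by linarith
    qed (use ab elim in linarith)+
    finally show ?case by simp
  qed
  moreover have "(\<lambda>n. 1 - disconnection_bound \<delta> \<epsilon> (real n)) \<longlonglongrightarrow> 1 - 0"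
    using \<epsilon> \<delta> by (intro tendsto_diff tendsto_const disconnection_bound_tendsto_0)
  moreover have "\<forall>\<^sub>F n in sequentially. p n \<le> 1" by (simp add: p_def)
  ultimately have "p \<longlonglongrightarrow> 1"
    by (intro real_tendsto_sandwich[of "\<lambda>n. 1 - disconnection_bound \<delta> \<epsilon> (real n)" p _ "\<lambda>_. 1" 1]) simp_all
  then show ?thesis unfolding maker_wins_aas_def p_def .
qed


section \<open>Attacking isolated vertices\<close>

definition isolated :: "nat \<Rightarrow> nat \<Rightarrow> history \<Rightarrow> nat set" where
  "isolated n a h = {v. v < n \<and> (\<forall>e\<in>maker_edges a h. v \<notin> e)}"

text \<open>
  The set of isolated vertices only shrinks, so the least of them stays the target until Maker hits
  it: an attempt, once begun, is pursued without any memory of it.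
\<close>

definition target :: "nat \<Rightarrow> nat \<Rightarrow> history \<Rightarrow> nat" where
  "target n a h = (LEAST v. v \<in> isolated n a h)"

definition free_at :: "nat \<Rightarrow> history \<Rightarrow> nat \<Rightarrow> nat set set" where
  "free_at n h v = {e \<in> free_edges n h. v \<in> e}"

definition attack_strategy :: "nat \<Rightarrow> nat \<Rightarrow> strategy" where
  "attack_strategy n a h =
     (if isolated n a h \<noteq> {} \<and> free_at n h (target n a h) \<noteq> {}
      then SOME e. e \<in> free_at n h (target n a h)
      else SOME e. e \<in> free_edges n h)"

lemma attack_strategy_free_at:
  assumes "isolated n a h \<noteq> {}" "free_at n h (target n a h) \<noteq> {}"
  shows "attack_strategy n a h \<in> free_at n h (target n a h)"
proof -
  have "\<exists>e. e \<in> free_at n h (target n a h)" using assms by blast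
  then have "(SOME e. e \<in> free_at n h (target n a h)) \<in> free_at n h (target n a h)" by (rule someI_ex)
  then show ?thesis using assms by (simp only: attack_strategy_def) simp
qed

lemma breaker_strategy_attack_strategy: "breaker_strategy n a (attack_strategy n a)"
  unfolding breaker_strategy_def
proof (intro allI impI, elim conjE)
  fix h assume ne: "free_edges n h \<noteq> {}"
  show "attack_strategy n a h \<in> free_edges n h"
  proof (cases "isolated n a h \<noteq> {} \<and> free_at n h (target n a h) \<noteq> {}")
    case True
    then have "attack_strategy n a h \<in> free_at n h (target n a h)" by (intro attack_strategy_free_at) auto
    then show ?thesis by (simp add: free_at_def)
  next
    case False
    have "\<exists>e. e \<in> free_edges n h" using ne by blast
    then have "(SOME e. e \<in> free_edges n h) \<in> free_edges n h" by (rule someI_ex)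
    then show ?thesis using False by (simp only: attack_strategy_def if_False)
  qed
qed

lemma finite_isolated [simp]: "finite (isolated n a h)"
  by (simp add: isolated_def)

lemma finite_free_at [simp]: "finite (free_at n h v)"
  by (simp add: free_at_def)

lemma target_in_isolated: "isolated n a h \<noteq> {} \<Longrightarrow> target n a h \<in> isolated n a h"
  unfolding target_def by (rule LeastI_ex) blast

lemma isolated_append:
  "isolated n a (h @ [e]) = (if maker_to_move a (length h) then isolated n a h - e else isolated n a h)"
  by (auto simp: isolated_def maker_edges_append)

lemma free_at_append: "free_at n (h @ [e]) v = free_at n h v - {e}"
  by (auto simp: free_at_def free_edges_append)

lemma target_append:
  assumes "isolated n a h \<noteq> {}" "\<not> maker_to_move a (length h) \<or> target n a h \<notin> e"
  shows "target n a (h @ [e]) = target n a h"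
proof (cases "maker_to_move a (length h)")
  case True
  have "target n a h \<in> isolated n a (h @ [e])"
    using target_in_isolated[OF assms(1)] assms(2) True by (simp add: isolated_append)
  moreover have "target n a h \<le> v" if "v \<in> isolated n a (h @ [e])" for v
    using that True unfolding target_def by (intro Least_le) (simp add: isolated_append)
  ultimately show ?thesis unfolding target_def[of n a "h @ [e]"] by (rule Least_equality)
next
  case False
  then show ?thesis by (simp add: target_def isolated_append)
qed

lemma card_free_at_le:
  assumes "v < n"
  shows "card (free_at n h v) \<le> n - 1"
proof -
  have "free_at n h v \<subseteq> edges_between {v} ({..<n} - {v})"
  proof
    fix e assume "e \<in> free_at n h v"
    then have e: "v \<in> e" "e \<subseteq> {..<n}" "card e = 2"
      by (auto simp: free_at_def free_edges_def complete_edges_def)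
    then have "card (e - {v}) = 1" by (simp add: card_Diff_singleton)
    then obtain w where w: "e - {v} = {w}" by (rule card_1_singletonE)
    then have "e = {v, w}" "w \<in> {..<n} - {v}" using e by auto
    then show "e \<in> edges_between {v} ({..<n} - {v})" by (auto intro: edges_betweenI)
  qed
  then have "card (free_at n h v) \<le> card (edges_between {v} ({..<n} - {v}))"
    by (intro card_mono finite_edges_between) auto
  also have "\<dots> = n - 1" using assms by (subst card_edges_between) auto
  finally show ?thesis .
qed

lemma connected_graph_not_isolated:
  assumes "connected_graph n (maker_edges a h)" "2 \<le> n"
  shows "isolated n a h = {}"
proof (rule ccontr)
  assume "isolated n a h \<noteq> {}"
  then obtain v where v: "v < n" "\<And>e. e \<in> maker_edges a h \<Longrightarrow> v \<notin> e" by (auto simp: isolated_def)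
  define u where "u = (if v = 0 then 1 else 0 :: nat)"
  have u: "u < n" "u \<noteq> v" using assms(2) by (auto simp: u_def)
  have "(v, u) \<in> {(x, y). {x, y} \<in> maker_edges a h}\<^sup>*"
    using assms(1) u v(1) by (simp add: connected_graph_def)
  then show False
  proof (cases rule: converse_rtranclE)
    case (step y)
    then have "{v, y} \<in> maker_edges a h" by simp
    then show False using v(2) by blast
  qed (use u in simp)
qed

lemma sum_card_isolated_Int:
  "(\<Sum>e\<in>free_edges n h. card (e \<inter> isolated n a h)) \<le> card (isolated n a h) * n"
proof -
  have "(\<Sum>e\<in>free_edges n h. card (e \<inter> isolated n a h)) = (\<Sum>v\<in>isolated n a h. card (free_at n h v))"
    unfolding free_at_def
    using sum_multicount_gen[of "isolated n a h" "free_edges n h" "\<lambda>v e. v \<in> e" "\<lambda>e. card (e \<inter> isolated n a h)"]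
    by (simp add: Int_def conj_commute)
  also have "\<dots> \<le> (\<Sum>v\<in>isolated n a h. n)"
  proof (rule sum_mono)
    fix v assume "v \<in> isolated n a h"
    then have "card (free_at n h v) \<le> n - 1" by (intro card_free_at_le) (simp add: isolated_def)
    then show "card (free_at n h v) \<le> n" by simp
  qed
  finally show ?thesis by simp
qed

text \<open>
  A Maker move reduces the number of isolated vertices by at most two, so the reciprocal of one plus their number grows
  by a factor that is linear in the number \<open>d\<close> of vertices lost.
\<close>

lemma inverse_drop_le:
  fixes y d :: real
  assumes "3 \<le> y" "0 \<le> d" "d \<le> 2"
  shows "1 / (y - d) \<le> 1 / y * (1 + 3 * d / y)"
proof -
  have "y / 3 \<le> y - d" using assms by simp
  then have "d / (y - d) \<le> d / (y / 3)" using assms by (intro divide_left_mono) auto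
  then have "1 + d / (y - d) \<le> 1 + 3 * d / y" by (simp add: mult.commute)
  then have "1 / y * (1 + d / (y - d)) \<le> 1 / y * (1 + 3 * d / y)"
    using assms by (intro mult_left_mono) auto
  moreover have "1 / y * (1 + d / (y - d)) = 1 / (y - d)"
    using assms by (simp add: divide_simps)
  ultimately show ?thesis by simp
qed

text \<open>
  Only attempts that are completed within Breaker's first \<open>R\<close> moves are counted. Until then, each
  Maker move hits each free edge with probability at most \<open>q\<close>. A new attempt succeeds with
  probability at least \<open>p0\<close>.
\<close>

context
  fixes n a R :: nat and q p0 :: real
  assumes n: "2 \<le> n" and R: "n \<le> R" and q: "0 \<le> q" "real n * q \<le> 1"
    and free: "1 \<le> (real (card (complete_edges n)) - real (R * Suc a)) * q"
  defines "p0 \<equiv> survival q a (n - 1) a"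
begin

definition target_freedom :: "history \<Rightarrow> nat" where
  "target_freedom h = card (free_at n h (target n a h))"

definition breaker_done :: "history \<Rightarrow> bool" where
  "breaker_done h \<longleftrightarrow> (\<exists>v\<in>isolated n a h. free_at n h v = {})"

text \<open>
  The sum of the number of Breaker moves made so far and of the target's freedom is the
  number of moves after which the current attempt will be completed; it does not change during an
  attempt. The next attempt begins with the failure of this one and takes fewer than \<open>n\<close> moves. It
  fails with probability at most \<open>1 - p0 \<le> exp (- p0)\<close>, so that each Breaker move left before the
  deadline \<open>R\<close> is worth a factor \<open>exp (- p0 / n)\<close>. Subtracting another \<open>n\<close> makes the discount at
  least 1 whenever a failure could lead to an attempt that misses the deadline.
\<close>

definition attempt_discount :: "history \<Rightarrow> real" where
  "attempt_discount h =
     exp (- (p0 / real n * (real R - real n - real (length h div Suc a) - real (target_freedom h))))"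

definition attempt_failure :: "history \<Rightarrow> real" where
  "attempt_failure h =
     1 - survival q a (target_freedom h) (a - length h mod Suc a)"

text \<open>
  A bound for the probability that the targets run out before the deadline. The factor 2 makes it at
  least 1 when only one isolated vertex is left; the exponential compensates the expected growth of
  the reciprocal in the moves that remain.
\<close>

definition scarcity :: "history \<Rightarrow> real" where
  "scarcity h = exp (3 * real n * q * (real (R * Suc a) - real (length h)))
     * (2 / (real (card (isolated n a h)) + 1))"

text \<open>
  An upper bound for the probability that Breaker fails. It is set to 1 as soon as the current
  attempt will not be completed before the deadline or at most one isolated vertex is left, so that
  only the situations before that need an estimate.
\<close>

definition breaker_risk :: "history \<Rightarrow> real" where
  "breaker_risk h =
     (if breaker_done h then 0
      else if card (isolated n a h) \<le> 1 \<or> R \<le> length h div Suc a + target_freedom h then 1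
      else min 1 (attempt_failure h * attempt_discount h + scarcity h))"

lemma target_freedom_le:
  assumes "isolated n a h \<noteq> {}" shows "target_freedom h \<le> n - 1"
  unfolding target_freedom_def
  using target_in_isolated[OF assms] by (intro card_free_at_le) (simp add: isolated_def)

lemma q_bound: "i \<le> n \<Longrightarrow> real i * q \<le> 1"
  using mult_right_mono[of "real i" "real n" q] q by auto

lemma p0_bounds: "0 \<le> p0" "p0 \<le> 1"
  unfolding p0_def by (intro survival_nonneg survival_le_1 q q_bound; simp)+

lemma survival_target:
  assumes "isolated n a h \<noteq> {}" "m \<le> a"
  shows "p0 \<le> survival q a (target_freedom h) m" "survival q a (target_freedom h) m \<le> 1"
proof -
  have g: "target_freedom h \<le> n - 1" by (rule target_freedom_le[OF assms(1)])
  show "p0 \<le> survival q a (target_freedom h) m"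
    unfolding p0_def by (rule survival_antimono[OF q(1) q_bound g assms(2)]) (use assms in auto)
  show "survival q a (target_freedom h) m \<le> 1"
    by (rule survival_le_1[OF q(1) q_bound]) (use g in simp)
qed

lemma attempt_discount_pos: "0 < attempt_discount h"
  by (simp add: attempt_discount_def)

lemma scarcity_nonneg: "0 \<le> scarcity h"
  by (simp add: scarcity_def)

lemma attempt_failure_nonneg: "isolated n a h \<noteq> {} \<Longrightarrow> 0 \<le> attempt_failure h"
  using survival_target(2)[of h "a - length h mod Suc a"] by (simp add: attempt_failure_def)

lemma breaker_risk_nonneg: "0 \<le> breaker_risk h"
proof -
  have "0 \<le> attempt_failure h" if "\<not> card (isolated n a h) \<le> 1"
    using that by (intro attempt_failure_nonneg) auto
  then show ?thesis
    using attempt_discount_pos[of h] scarcity_nonneg[of h] by (simp add: breaker_risk_def)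
qed

lemma breaker_risk_le_1: "breaker_risk h \<le> 1"
  by (simp add: breaker_risk_def)

lemma breaker_risk_not_1:
  assumes "\<not> breaker_done h" "breaker_risk h \<noteq> 1"
  shows "2 \<le> card (isolated n a h)" "length h div Suc a + target_freedom h < R"
    "breaker_risk h = attempt_failure h * attempt_discount h + scarcity h"
  using assms unfolding breaker_risk_def by (auto simp: min_def split: if_splits)

lemma length_less_horizon:
  assumes "length h div Suc a < R" shows "length h < R * Suc a"
  using assms by (simp add: div_less_iff_less_mult del: mult_Suc_right)

lemma scarcity_ge_1:
  assumes "length h \<le> R * Suc a" "card (isolated n a h) \<le> 1"
  shows "1 \<le> scarcity h"
proof -
  have "(1::real) * 1 \<le> scarcity h"
    unfolding scarcity_def
  proof (rule mult_mono)
    have "real (length h) \<le> real (R * Suc a)" using assms(1) by (rule of_nat_mono)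
    then show "1 \<le> exp (3 * real n * q * (real (R * Suc a) - real (length h)))"
      using q by (subst one_le_exp_iff) (intro mult_nonneg_nonneg, auto)
    show "1 \<le> 2 / (real (card (isolated n a h)) + 1)" using assms(2) by (simp add: divide_simps)
  qed auto
  then show ?thesis by simp
qed

text \<open>
  Averaged over Maker's moves, the number of isolated vertices drops by at most \<open>n / F\<close> times this
  number, where \<open>F\<close> is the number of free edges, and \<open>1 / F \<le> q\<close> before the deadline. So the
  reciprocal grows by a factor of at most \<open>1 + 3 n q \<le> exp (3 n q)\<close>.
\<close>

lemma sum_scarcity_le:
  assumes h: "valid_history n h" "length h < R * Suc a" "maker_to_move a (length h)"
    and I: "2 \<le> card (isolated n a h)"
  shows "(\<Sum>e\<in>free_edges n h. scarcity (h @ [e])) \<le> real (card (free_edges n h)) * scarcity h"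
proof -
  let ?F = "free_edges n h"
  define I where "I = isolated n a h"
  define y where "y = real (card I) + 1"
  define A where "A = exp (3 * real n * q * (real (R * Suc a) - real (Suc (length h))))"
  have y: "3 \<le> y" using I by (simp add: y_def I_def)
  have "scarcity (h @ [e]) \<le> A * (2 * (1 / y * (1 + 3 * real (card (e \<inter> I)) / y)))" if e: "e \<in> ?F" for e
  proof -
    have "card e = 2" using e by (auto simp: free_edges_def complete_edges_def)
    then have d: "card (e \<inter> I) \<le> 2"
      using card_mono[of e "e \<inter> I"] card.infinite[of e] by (metis Int_lower1 zero_neq_numeral)
    have "card (I - e) + card (e \<inter> I) = card I"
      using card_Int_Diff[of I e] by (simp add: I_def Int_commute)
    then have "real (card (isolated n a (h @ [e]))) + 1 = y - real (card (e \<inter> I))"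
      using h(3) by (simp add: isolated_append I_def y_def)
    then have "scarcity (h @ [e]) = A * (2 * (1 / (y - real (card (e \<inter> I)))))"
      by (simp add: scarcity_def A_def)
    also have "\<dots> \<le> A * (2 * (1 / y * (1 + 3 * real (card (e \<inter> I)) / y)))"
      using y d by (intro mult_left_mono inverse_drop_le) (auto simp: A_def)
    finally show ?thesis .
  qed
  then have "(\<Sum>e\<in>?F. scarcity (h @ [e])) \<le> (\<Sum>e\<in>?F. A * (2 * (1 / y * (1 + 3 * real (card (e \<inter> I)) / y))))"
    by (rule sum_mono)
  also have "\<dots> = A * (2 * (1 / y * (real (card ?F) + 3 * real (\<Sum>e\<in>?F. card (e \<inter> I)) / y)))"
    by (simp add: sum.distrib sum_distrib_left sum_divide_distrib algebra_simps)
  also have "\<dots> \<le> A * (2 * (1 / y * (real (card ?F) * exp (3 * real n * q))))"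
  proof (intro mult_left_mono)
    have "real (\<Sum>e\<in>?F. card (e \<inter> I)) \<le> real (card I * n)"
      using sum_card_isolated_Int[of n a h] unfolding I_def by (rule of_nat_mono)
    also have "\<dots> \<le> real n * y" by (simp add: y_def algebra_simps)
    finally have "real (\<Sum>e\<in>?F. card (e \<inter> I)) / y \<le> real n" using y by (simp add: divide_le_eq)
    moreover have "1 \<le> real (card ?F) * q"
    proof -
      have "length h < R * Suc a" by (rule h(2))
      then have "real (length h) \<le> real (R * Suc a)" by (intro of_nat_mono) simp
      moreover have "real (card ?F) = real (card (complete_edges n)) - real (length h)"
        using card_free_edges[OF h(1)] valid_history_length[OF h(1)] by simp
      ultimately have "(real (card (complete_edges n)) - real (R * Suc a)) * q \<le> real (card ?F) * q"
        using q(1) by (intro mult_right_mono) linarith+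
      then show ?thesis using free by linarith
    qed
    then have "3 * real n * 1 \<le> 3 * real n * (real (card ?F) * q)" by (rule mult_left_mono) simp
    moreover have "real (card ?F) * (1 + 3 * real n * q) \<le> real (card ?F) * exp (3 * real n * q)"
      by (intro mult_left_mono exp_ge_add_one_self) simp
    ultimately show "real (card ?F) + 3 * real (\<Sum>e\<in>?F. card (e \<inter> I)) / y \<le> real (card ?F) * exp (3 * real n * q)"
      by (simp add: algebra_simps)
  qed (use y in \<open>auto simp: A_def\<close>)
  also have "\<dots> = real (card ?F) * (A * exp (3 * real n * q) * (2 / y))" by simp
  also have "A * exp (3 * real n * q) = exp (3 * real n * q * (real (R * Suc a) - real (length h)))"
    unfolding A_def exp_add[symmetric] by (rule arg_cong[where f = exp]) (simp add: algebra_simps)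
  finally show ?thesis by (simp add: scarcity_def y_def I_def)
qed

text \<open>
  Let \<open>g\<close> of the \<open>F\<close> free edges be at the target. If Maker hits one of them, the failure probability
  \<open>1 - survival\<close> is replaced by that of a fresh attempt, which together with its discount is at most
  the current discount \<open>E\<close>. If he misses, the attempt goes on with one Maker move less in the round.
  Since \<open>g / F \<le> g q\<close>, the average of the two is at most the present value.
\<close>

lemma breaker_risk_maker:
  assumes h: "valid_history n h" "maker_to_move a (length h)"
  shows "(\<Sum>e\<in>free_edges n h. breaker_risk (h @ [e])) \<le> real (card (free_edges n h)) * breaker_risk h"
proof -
  let ?F = "free_edges n h"
  consider "breaker_done h" | "breaker_risk h = 1" | "\<not> breaker_done h" "breaker_risk h \<noteq> 1" by blast
  then show ?thesis
  proof cases
    case 1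
    then obtain v where v: "v \<in> isolated n a h" "free_at n h v = {}" by (auto simp: breaker_done_def)
    have "breaker_risk (h @ [e]) = 0" if "e \<in> ?F" for e
    proof -
      have "v \<notin> e" using v(2) that by (auto simp: free_at_def)
      then have "breaker_done (h @ [e])"
        using v by (auto simp: breaker_done_def isolated_append free_at_append intro!: bexI[of _ v])
      then show ?thesis by (simp add: breaker_risk_def)
    qed
    then show ?thesis using breaker_risk_nonneg by simp
  next
    case 2
    then show ?thesis using sum_mono[of ?F "\<lambda>e. breaker_risk (h @ [e])" "\<lambda>_. 1"] breaker_risk_le_1 by simp
  next
    case 3
    note risk = breaker_risk_not_1[OF 3]
    define g where "g = target_freedom h"
    define \<tau> where "\<tau> = length h div Suc a"
    define m where "m = a - Suc (length h mod Suc a)"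
    define E where "E = attempt_discount h"
    define s where "s = survival q a g m"
    have iso: "isolated n a h \<noteq> {}" using risk(1) by auto
    have len: "length h < R * Suc a" using risk(2) by (intro length_less_horizon) simp
    have m: "a - length h mod Suc a = Suc m" "a - length (h @ [e]) mod Suc a = m"
      and \<tau>: "length (h @ [e]) div Suc a = \<tau>" for e
      using maker_turn_Suc[OF h(2)] by (simp_all add: m_def \<tau>_def)
    have E: "0 < E" by (simp add: E_def attempt_discount_pos)
    have g: "g \<le> n - 1" unfolding g_def by (rule target_freedom_le[OF iso])
    have s: "0 \<le> s" unfolding s_def by (rule survival_nonneg[OF q(1) q_bound]) (use g in simp)
    have few: "1 \<le> scarcity (h @ [e])" if "card (isolated n a (h @ [e])) \<le> 1" for e
      using len that by (intro scarcity_ge_1) auto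
    have miss: "breaker_risk (h @ [e]) \<le> (1 - s) * E + scarcity (h @ [e])"
      if e: "e \<in> ?F - free_at n h (target n a h)" for e
    proof -
      have "target n a h \<notin> e" using e by (auto simp: free_at_def)
      then have tgt: "target n a (h @ [e]) = target n a h" by (intro target_append[OF iso]) simp
      have "free_at n (h @ [e]) (target n a h) = free_at n h (target n a h)"
        using e by (auto simp: free_at_append)
      then have g': "target_freedom (h @ [e]) = g" by (simp add: target_freedom_def tgt g_def)
      have "attempt_failure (h @ [e]) = 1 - s" by (simp only: attempt_failure_def g' m s_def)
      moreover have "attempt_discount (h @ [e]) = E"
        unfolding attempt_discount_def E_def g' \<tau> by (simp add: \<tau>_def g_def)
      moreover have "0 \<le> (1 - s) * E"
        using E survival_le_1[OF q(1) q_bound, of g a m] g by (simp add: s_def)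
      moreover have "\<not> R \<le> length (h @ [e]) div Suc a + target_freedom (h @ [e])"
        unfolding \<tau> g' using risk(2) by (simp add: \<tau>_def g_def)
      ultimately show ?thesis
        using few[of e] scarcity_nonneg[of "h @ [e]"] by (auto simp: breaker_risk_def)
    qed
    \<comment> \<open>A hit at worst leads to a fresh attempt, whose risk is at most the discount \<open>E\<close>.\<close>
    have hit: "breaker_risk (h @ [e]) \<le> E + scarcity (h @ [e])" for e
    proof -
      consider "breaker_done (h @ [e])" | "card (isolated n a (h @ [e])) \<le> 1"
        | "2 \<le> card (isolated n a (h @ [e]))" "R \<le> \<tau> + target_freedom (h @ [e])"
        | "\<not> breaker_done (h @ [e])" "2 \<le> card (isolated n a (h @ [e]))" "\<not> R \<le> \<tau> + target_freedom (h @ [e])"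
        by fastforce
      then show ?thesis
      proof cases
        case 1
        then show ?thesis using E scarcity_nonneg[of "h @ [e]"] by (simp add: breaker_risk_def)
      next
        case 2
        then show ?thesis using few[of e] breaker_risk_le_1[of "h @ [e]"] E by linarith
      next
        case 3
        then have "isolated n a (h @ [e]) \<noteq> {}" by auto
        then have "target_freedom (h @ [e]) \<le> n - 1" by (rule target_freedom_le)
        then have "R \<le> \<tau> + n" using 3(2) by simp
        then have "real R \<le> real (\<tau> + n)" by (rule of_nat_mono)
        then have "p0 / real n * (real R - real n - real \<tau> - real g) \<le> 0"
          using p0_bounds by (intro mult_nonneg_nonpos) auto
        then have "1 \<le> E" unfolding E_def attempt_discount_def \<tau>_def g_def by simp
        then show ?thesis using breaker_risk_le_1[of "h @ [e]"] scarcity_nonneg[of "h @ [e]"] by linarith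
      next
        case 4
        define g' where "g' = target_freedom (h @ [e])"
        have iso': "isolated n a (h @ [e]) \<noteq> {}" using 4(2) by auto
        then have g': "g' \<le> n - 1" unfolding g'_def by (rule target_freedom_le)
        define E' where "E' = attempt_discount (h @ [e])"
        have "attempt_failure (h @ [e]) \<le> 1 - p0"
          using survival_target(1)[OF iso', of m] unfolding attempt_failure_def m by (simp add: m_def)
        also have "\<dots> \<le> exp (- p0)" using exp_ge_add_one_self[of "- p0"] by simp
        finally have "attempt_failure (h @ [e]) * E' \<le> exp (- p0) * E'"
          by (rule mult_right_mono) (simp add: E'_def attempt_discount_pos less_imp_le)
        also have "\<dots> \<le> E"
        proof -
          have "p0 / real n * real g' \<le> p0 / real n * real n"
            using g' p0_bounds by (intro mult_left_mono) auto
          then have "p0 / real n * real g' \<le> p0" using n by simp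
          moreover have "0 \<le> p0 / real n * real g" using p0_bounds by simp
          ultimately have "- p0 + - (p0 / real n * (real R - real n - real \<tau> - real g'))
              \<le> - (p0 / real n * (real R - real n - real \<tau> - real g))"
            by (simp add: right_diff_distrib)
          then show ?thesis
            unfolding E'_def E_def attempt_discount_def exp_add[symmetric] \<tau>
            by (simp add: g'_def g_def \<tau>_def)
        qed
        finally have "attempt_failure (h @ [e]) * E' \<le> E" .
        moreover have "breaker_risk (h @ [e]) \<le> attempt_failure (h @ [e]) * E' + scarcity (h @ [e])"
          using 4 unfolding breaker_risk_def \<tau> E'_def by simp
        ultimately show ?thesis by linarith
      qed
    qed
    have at: "free_at n h (target n a h) \<subseteq> ?F" by (auto simp: free_at_def)
    have cg: "card (free_at n h (target n a h)) = g" by (simp add: g_def target_freedom_def)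
    have "(\<Sum>e\<in>?F. breaker_risk (h @ [e])) =
        (\<Sum>e\<in>?F - free_at n h (target n a h). breaker_risk (h @ [e]))
        + (\<Sum>e\<in>free_at n h (target n a h). breaker_risk (h @ [e]))"
      by (rule sum.subset_diff[OF at]) simp
    also have "\<dots> \<le> (\<Sum>e\<in>?F - free_at n h (target n a h). (1 - s) * E + scarcity (h @ [e]))
        + (\<Sum>e\<in>free_at n h (target n a h). E + scarcity (h @ [e]))"
      by (intro add_mono sum_mono miss hit)
    also have "\<dots> = real (card (?F - free_at n h (target n a h))) * ((1 - s) * E) + real g * E
        + ((\<Sum>e\<in>?F - free_at n h (target n a h). scarcity (h @ [e]))
           + (\<Sum>e\<in>free_at n h (target n a h). scarcity (h @ [e])))"
      by (simp add: sum.distrib cg)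
    also have "(\<Sum>e\<in>?F - free_at n h (target n a h). scarcity (h @ [e]))
           + (\<Sum>e\<in>free_at n h (target n a h). scarcity (h @ [e])) = (\<Sum>e\<in>?F. scarcity (h @ [e]))"
      by (rule sum.subset_diff[OF at, symmetric]) simp
    also have "\<dots> \<le> real (card ?F) * scarcity h"
      by (rule sum_scarcity_le[OF h(1) len h(2) risk(1)])
    also have "real (card (?F - free_at n h (target n a h))) = real (card ?F) - real g"
      using at by (simp add: card_Diff_subset cg[symmetric] card_mono of_nat_diff)
    also have "(real (card ?F) - real g) * ((1 - s) * E) + real g * E
        \<le> real (card ?F) * ((1 - (1 - real g * q) * s) * E)"
    proof -
      have "1 \<le> real (card ?F) * q"
      proof -
        have "real (length h) \<le> real (R * Suc a)" using len by (intro of_nat_mono) simp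
        moreover have "real (card ?F) = real (card (complete_edges n)) - real (length h)"
          using card_free_edges[OF h(1)] valid_history_length[OF h(1)] by simp
        ultimately have "(real (card (complete_edges n)) - real (R * Suc a)) * q \<le> real (card ?F) * q"
          using q(1) by (intro mult_right_mono) linarith+
        then show ?thesis using free by linarith
      qed
      then have "real g * s * E * 1 \<le> real g * s * E * (real (card ?F) * q)"
        using s E by (intro mult_left_mono) auto
      then show ?thesis by (simp add: algebra_simps)
    qed
    also have "(1 - (1 - real g * q) * s) * E = attempt_failure h * attempt_discount h"
      unfolding attempt_failure_def m survival_Suc by (simp add: s_def E_def g_def)
    finally show ?thesis by (simp add: risk(3) algebra_simps)
  qed
qed

text \<open>
  By \<open>survival_Suc_0\<close>, claiming an edge at the target changes neither the failure
  probability nor the discount.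
\<close>

lemma breaker_risk_breaker:
  assumes h: "valid_history n h" "\<not> maker_to_move a (length h)"
    and Sh: "attack_strategy n a h \<in> free_edges n h"
  shows "breaker_risk (h @ [attack_strategy n a h]) \<le> breaker_risk h"
proof -
  define e where "e = attack_strategy n a h"
  have isoe: "isolated n a (h @ [e]) = isolated n a h" using h(2) by (simp add: isolated_append)
  consider "breaker_done h" | "breaker_risk h = 1" | "\<not> breaker_done h" "breaker_risk h \<noteq> 1" by blast
  then have "breaker_risk (h @ [e]) \<le> breaker_risk h"
  proof cases
    case 1
    then have "breaker_done (h @ [e])" unfolding breaker_done_def isoe free_at_append by auto
    then show ?thesis using breaker_risk_nonneg by (simp add: breaker_risk_def[of "h @ [e]"])
  next
    case 2
    then show ?thesis using breaker_risk_le_1 by simp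
  next
    case 3
    note risk = breaker_risk_not_1[OF 3]
    have iso: "isolated n a h \<noteq> {}" using risk(1) by auto
    have "free_at n h (target n a h) \<noteq> {}"
      using 3(1) target_in_isolated[OF iso] by (auto simp: breaker_done_def)
    then have e: "e \<in> free_at n h (target n a h)"
      unfolding e_def by (rule attack_strategy_free_at[OF iso])
    have tgt: "target n a (h @ [e]) = target n a h" using h(2) by (intro target_append[OF iso]) simp
    have g: "target_freedom h = Suc (target_freedom (h @ [e]))"
      using card_Suc_Diff1[OF finite_free_at e] by (simp add: target_freedom_def tgt free_at_append)
    have \<tau>: "length (h @ [e]) div Suc a = Suc (length h div Suc a)"
      "length (h @ [e]) mod Suc a = 0" "length h mod Suc a = a"
      using breaker_turn_Suc[OF h(2)] by simp_all
    have "attempt_failure (h @ [e]) = attempt_failure h"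
      unfolding attempt_failure_def \<tau> g by (simp add: survival_Suc_0)
    moreover have "attempt_discount (h @ [e]) = attempt_discount h"
      unfolding attempt_discount_def \<tau> g by simp
    moreover have "scarcity (h @ [e]) \<le> scarcity h"
      unfolding scarcity_def isoe
      by (intro mult_right_mono exp_le_cancel_iff[THEN iffD2] mult_left_mono) (use q in auto)
    moreover have "breaker_risk (h @ [e]) \<le> attempt_failure (h @ [e]) * attempt_discount (h @ [e]) + scarcity (h @ [e])"
    proof (cases "breaker_done (h @ [e])")
      case True
      have "isolated n a (h @ [e]) \<noteq> {}" using iso isoe by simp
      then show ?thesis
        using True attempt_failure_nonneg[of "h @ [e]"] attempt_discount_pos[of "h @ [e]"] scarcity_nonneg[of "h @ [e]"]
        by (simp add: breaker_risk_def)
    next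
      case False
      then show ?thesis using risk(1,2) unfolding breaker_risk_def \<tau> isoe g by simp
    qed
    ultimately show ?thesis unfolding risk(3) by simp
  qed
  then show ?thesis by (simp add: e_def)
qed

lemma prob_connected_le:
  "measure_pmf.prob (half_random_game n a (attack_strategy n a)) {h. connected_graph n (maker_edges a h)}
    \<le> exp (- (p0 / real n * (real R - 2 * real n)))
      + exp (3 * real n * q * real (R * Suc a)) * (2 / (real n + 1))"
proof -
  let ?S = "attack_strategy n a"
  have "measure_pmf.prob (play_on n a ?S [] (card (complete_edges n))) {h. connected_graph n (maker_edges a h)}
      \<le> breaker_risk []"
  proof (rule prob_play_on_le[where m = "card (complete_edges n)"])
    fix h assume "h \<in> {h. connected_graph n (maker_edges a h)}"
    then have "isolated n a h = {}" using connected_graph_not_isolated n by simp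
    then show "1 \<le> breaker_risk h" by (simp add: breaker_risk_def breaker_done_def)
  qed (use breaker_strategy_attack_strategy breaker_risk_nonneg breaker_risk_maker breaker_risk_breaker in auto)
  also have "breaker_risk [] \<le> attempt_discount [] + scarcity []"
  proof -
    have iso: "isolated n a [] = {..<n}" by (auto simp: isolated_def)
    then have ne: "isolated n a [] \<noteq> {}" using n by (auto simp: lessThan_empty_iff)
    have "target_freedom [] \<le> n - 1" by (rule target_freedom_le[OF ne])
    then have "\<not> R \<le> length ([] :: history) div Suc a + target_freedom []" using R n by simp
    then have "breaker_risk [] \<le> max 0 (attempt_failure [] * attempt_discount [] + scarcity [])"
      using iso n by (simp add: breaker_risk_def min_le_iff_disj le_max_iff_disj)
    also have "\<dots> \<le> 1 * attempt_discount [] + scarcity []"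
    proof -
      have "attempt_failure [] \<le> 1"
        using survival_target(1)[OF ne, of a] p0_bounds by (simp add: attempt_failure_def)
      then have "attempt_failure [] * attempt_discount [] \<le> 1 * attempt_discount []"
        using attempt_discount_pos[of "[]"] by (intro mult_right_mono) auto
      then show ?thesis using attempt_discount_pos[of "[]"] scarcity_nonneg[of "[]"] by simp
    qed
    finally show ?thesis by simp
  qed
  also have "attempt_discount [] \<le> exp (- (p0 / real n * (real R - 2 * real n)))"
  proof -
    have "0 \<in> isolated n a []" using n by (simp add: isolated_def)
    then have "isolated n a [] \<noteq> {}" by blast
    then have "target_freedom [] \<le> n" using target_freedom_le[of "[]"] by simp
    then have "p0 / real n * (real R - 2 * real n) \<le> p0 / real n * (real R - real n - real (target_freedom []))"
      using p0_bounds by (intro mult_left_mono) auto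
    then show ?thesis by (simp add: attempt_discount_def)
  qed
  also have "scarcity [] = exp (3 * real n * q * real (R * Suc a)) * (2 / (real n + 1))"
    by (simp add: scarcity_def isolated_def)
  finally show ?thesis by (simp add: half_random_game_def half_random_play_eq_play_on)
qed

end


section \<open>Breaker wins below the threshold\<close>

lemma survival_ge_exp:
  assumes n: "0 < n" and q: "0 \<le> q" and small: "2 * (real n * q) \<le> \<delta>" "\<delta> \<le> 1"
  shows "exp (- (real a * ((1 + \<delta>) * (q * (real n)\<^sup>2 / 2)))) \<le> survival q a (n - 1) a"
proof -
  have \<delta>: "0 \<le> \<delta>" using q small mult_nonneg_nonneg[of "real n" q] by linarith
  have sum: "(\<Sum>i<n. real i) = real n * (real n - 1) / 2"
    by (induction n) (simp_all add: field_simps)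
  have "(\<Sum>i<n. real i * q * (1 + \<delta>)) = (\<Sum>i<n. real i) * q * (1 + \<delta>)"
    by (simp add: sum_distrib_right)
  also have "\<dots> \<le> (real n)\<^sup>2 / 2 * q * (1 + \<delta>)"
    unfolding sum using q \<delta> by (intro mult_right_mono) (auto simp: power2_eq_square algebra_simps)
  finally have S: "(\<Sum>i<n. real i * q * (1 + \<delta>)) \<le> (1 + \<delta>) * (q * (real n)\<^sup>2 / 2)"
    by (simp add: mult_ac)
  have "exp (- (real a * ((1 + \<delta>) * (q * (real n)\<^sup>2 / 2)))) \<le> exp (- (real a * (\<Sum>i<n. real i * q * (1 + \<delta>))))"
    using mult_left_mono[OF S, of "real a"] by simp
  also have "\<dots> = exp (\<Sum>i<n. real a * - (real i * q * (1 + \<delta>)))"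
    by (simp add: sum_negf sum_distrib_left)
  also have "\<dots> = (\<Prod>i<n. exp (- (real i * q * (1 + \<delta>))) ^ a)"
    by (simp only: exp_sum[OF finite_lessThan] exp_of_nat_mult)
  also have "\<dots> \<le> (\<Prod>i<n. (1 - real i * q) ^ a)"
  proof (intro prod_mono conjI power_mono)
    fix i assume "i \<in> {..<n}"
    define y where "y = real i * q"
    have "y \<le> real n * q" unfolding y_def using \<open>i \<in> {..<n}\<close> q by (intro mult_right_mono) auto
    then have y: "0 \<le> y" "2 * y \<le> \<delta>" "y \<le> 1 / 2" using small q by (auto simp: y_def)
    have "- (y * (1 + \<delta>)) \<le> - y - 2 * y\<^sup>2"
      using mult_left_mono[OF y(2), of y] y(1) by (simp add: power2_eq_square algebra_simps)
    also have "\<dots> \<le> ln (1 - y)" using y by (intro ln_one_minus_pos_lower_bound)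
    finally have "exp (- (y * (1 + \<delta>))) \<le> exp (ln (1 - y))" by simp
    also have "\<dots> = 1 - y" using y by simp
    finally show "exp (- (real i * q * (1 + \<delta>))) \<le> 1 - real i * q" by (simp add: y_def)
  qed auto
  also have "\<dots> = survival q a (Suc (n - 1)) 0" using n by (simp add: survival_def)
  also have "\<dots> = survival q a (n - 1) a" by (rule survival_Suc_0)
  finally show ?thesis .
qed

text \<open>
  The bound of \<open>prob_connected_le\<close> in terms of \<open>n\<close> and \<open>e\<close> alone. In the first summand, an attempt succeeds with
  probability at least \<open>(ln n) powr - (1 - e / 2)\<close>, and there is time for \<open>(ln n) powr (1 - e / 4)\<close>
  attempts. The second one tends to 0 because this time, \<open>n (ln n) powr (1 - e / 4)\<close> rounds, consists of
  fewer than order \<open>n ln n\<close> Maker moves.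
\<close>

definition connection_bound :: "real \<Rightarrow> real \<Rightarrow> real" where
  "connection_bound e n =
     exp (- (exp (- ((1 - e / 2) * ln (ln n))) * (exp ((1 - e / 4) * ln (ln n)) - 2)))
     + exp (12 * (exp ((1 - e / 4) * ln (ln n)) + 1) * (ln (ln n) + 1)) * (2 / (n + 1))"

lemma connection_bound_tendsto_0:
  assumes "0 < e" "e \<le> 1 / 2"
  shows "(\<lambda>n. connection_bound e (real n)) \<longlonglongrightarrow> 0"
proof -
  have "(\<lambda>n. exp (- (exp (- (c * ln (ln (real n)))) * (exp (d * ln (ln (real n))) - 2)))
      + exp (12 * (exp (d * ln (ln (real n))) + 1) * (ln (ln (real n)) + 1)) * (2 / (real n + 1))) \<longlonglongrightarrow> 0"
    if "0 < c" "c < d" "d < 1" for c d :: real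
    using that by real_asymp
  from this[of "1 - e / 2" "1 - e / 4"] show ?thesis
    unfolding connection_bound_def using assms by simp
qed

text \<open>
  Here \<open>q\<close> exceeds \<open>2 / n\<^sup>2\<close> by the factor \<open>1 + \<delta>\<close> only, because the observed rounds use up a
  vanishing fraction of the edges (\<open>n1\<close>). This precision matters: it makes \<open>p0\<close> at least
  \<open>exp (- (1 + \<delta>)\<^sup>2 a)\<close>, and \<open>\<delta> = e / 8\<close> gives \<open>(1 + \<delta>)\<^sup>2 (1 - e) \<le> 1 - e / 2\<close>.
\<close>

lemma prob_connected_le_connection_bound:
  fixes n a :: nat and e :: real
  defines "l \<equiv> ln (ln (real n))" and "\<delta> \<equiv> e / 8"
  defines "X \<equiv> exp ((1 - e / 4) * l)"
  assumes e: "0 < e" "e \<le> 1 / 2" and n: "2 \<le> n" and l: "0 \<le> l" and X2: "2 \<le> X"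
    and a: "real a \<le> (1 - e) * l"
    and n1: "(real n)\<^sup>2 / (2 * (1 + \<delta>)) \<le> real n * (real n - 1) / 2 - (real n * X + 1) * (l + 1)"
    and n2: "4 * (1 + \<delta>) / real n \<le> \<delta>"
  shows "measure_pmf.prob (half_random_game n a (attack_strategy n a)) {h. connected_graph n (maker_edges a h)}
    \<le> connection_bound e (real n)"
proof -
  define q where "q = 2 * (1 + \<delta>) / (real n)\<^sup>2"
  define R where "R = nat \<lceil>real n * X\<rceil>"
  define p0 where "p0 = survival q a (n - 1) a"
  have \<delta>: "0 < \<delta>" "\<delta> \<le> 1" using e by (simp_all add: \<delta>_def)
  have n0: "0 < real n" using n by simp
  have q: "0 \<le> q" using \<delta> by (simp add: q_def)
  have nq: "real n * q = 2 * (1 + \<delta>) / real n" using n by (simp add: q_def power2_eq_square)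
  then have nq\<delta>: "2 * (real n * q) \<le> \<delta>" using n2 by simp
  have nX: "0 \<le> real n * X" using X2 by simp
  have R: "real n * X \<le> real R" "real R \<le> real n * X + 1" using nX unfolding R_def by linarith+
  have nR: "n \<le> R"
  proof -
    have "real n * 1 \<le> real n * X" using X2 by (intro mult_left_mono) auto
    then have "real n \<le> real R" using R by linarith
    then show ?thesis by simp
  qed
  have al: "real a \<le> l" using a mult_right_mono[of "1 - e" 1 l] e l by simp
  have Ra: "real (R * Suc a) \<le> (real n * X + 1) * (l + 1)"
  proof -
    have "real (R * Suc a) = real R * (real a + 1)" by (simp add: algebra_simps)
    also have "\<dots> \<le> (real n * X + 1) * (l + 1)" using R(2) al nX by (intro mult_mono) auto
    finally show ?thesis .
  qed
  have free: "1 \<le> (real (card (complete_edges n)) - real (R * Suc a)) * q"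
  proof -
    have "(real n)\<^sup>2 / (2 * (1 + \<delta>)) \<le> real (card (complete_edges n)) - real (R * Suc a)"
      using n1 Ra unfolding real_card_complete_edges by linarith
    then have "(real n)\<^sup>2 / (2 * (1 + \<delta>)) * q \<le> (real (card (complete_edges n)) - real (R * Suc a)) * q"
      using q by (rule mult_right_mono)
    moreover have "(real n)\<^sup>2 / (2 * (1 + \<delta>)) * q = 1" using n \<delta> by (simp add: q_def)
    ultimately show ?thesis by linarith
  qed
  have bound: "measure_pmf.prob (half_random_game n a (attack_strategy n a)) {h. connected_graph n (maker_edges a h)}
    \<le> exp (- (p0 / real n * (real R - 2 * real n)))
      + exp (3 * real n * q * real (R * Suc a)) * (2 / (real n + 1))"
    unfolding p0_def by (rule prob_connected_le[OF n nR q _ free]) (use nq\<delta> \<delta> in linarith)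
  have p0: "exp (- ((1 - e / 2) * l)) \<le> p0"
  proof -
    have q2: "q * (real n)\<^sup>2 / 2 = 1 + \<delta>" using n by (simp add: q_def)
    have "exp (- (real a * ((1 + \<delta>) * (1 + \<delta>)))) \<le> p0"
      using survival_ge_exp[OF _ q nq\<delta> \<delta>(2), of a] n unfolding p0_def q2 by simp
    moreover have "real a * ((1 + \<delta>) * (1 + \<delta>)) \<le> (1 - e / 2) * l"
    proof -
      have "real a * ((1 + \<delta>) * (1 + \<delta>)) \<le> ((1 - e) * l) * ((1 + \<delta>) * (1 + \<delta>))"
        using a by (rule mult_right_mono) simp
      also have "\<dots> = ((1 - e) * ((1 + \<delta>) * (1 + \<delta>))) * l" by simp
      also have "\<dots> \<le> (1 - e / 2) * l"
      proof (rule mult_right_mono[OF _ l])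
        have "(1 + \<delta>) * (1 + \<delta>) \<le> 1 + 3 * \<delta>"
          using mult_left_mono[OF \<delta>(2), of \<delta>] \<delta> by (simp add: algebra_simps)
        then have "(1 - e) * ((1 + \<delta>) * (1 + \<delta>)) \<le> (1 - e) * (1 + 3 * \<delta>)"
          using e by (intro mult_left_mono) auto
        also have "\<dots> \<le> 1 - e / 2"
          using e mult_nonneg_nonneg[of e e] by (simp add: \<delta>_def algebra_simps)
        finally show "(1 - e) * ((1 + \<delta>) * (1 + \<delta>)) \<le> 1 - e / 2" .
      qed
      finally show ?thesis .
    qed
    ultimately show ?thesis by (meson exp_le_cancel_iff neg_le_iff_le order_trans)
  qed
  have b1: "exp (- (p0 / real n * (real R - 2 * real n))) \<le> exp (- (exp (- ((1 - e / 2) * l)) * (X - 2)))"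
  proof -
    have "X - 2 \<le> (real R - 2 * real n) / real n" using R(1) n0 by (simp add: field_simps)
    then have "exp (- ((1 - e / 2) * l)) * (X - 2) \<le> p0 * ((real R - 2 * real n) / real n)"
      using p0 X2 order_trans[OF exp_ge_zero p0] by (intro mult_mono) auto
    then show ?thesis by simp
  qed
  have b2: "exp (3 * real n * q * real (R * Suc a)) \<le> exp (12 * (X + 1) * (l + 1))"
  proof -
    have "3 * real n * q * real (R * Suc a) \<le> 3 * real n * q * ((real n * X + 1) * (l + 1))"
      using Ra q by (intro mult_left_mono) auto
    also have "\<dots> = 6 * (1 + \<delta>) * ((X + 1 / real n) * (l + 1))"
      using n by (simp add: q_def power2_eq_square field_simps)
    also have "\<dots> \<le> 12 * ((X + 1) * (l + 1))"
      using \<delta> l X2 n by (intro mult_mono mult_right_mono) (auto simp: divide_le_eq intro!: mult_nonneg_nonneg add_nonneg_nonneg)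
    finally show ?thesis by (simp only: exp_le_cancel_iff mult.assoc)
  qed
  have "exp (3 * real n * q * real (R * Suc a)) * (2 / (real n + 1)) \<le> exp (12 * (X + 1) * (l + 1)) * (2 / (real n + 1))"
    using b2 by (rule mult_right_mono) simp
  with bound b1 show ?thesis unfolding connection_bound_def l_def X_def by linarith
qed

lemma maker_loses_below_threshold:
  assumes \<epsilon>: "0 < \<epsilon>" and a: "rounding_of a (\<lambda>n. (1 - \<epsilon>) * ln (ln (real n)))"
  shows "maker_loses_aas connected_graph a (\<lambda>n. attack_strategy n (a n))"
proof -
  \<comment> \<open>For \<open>\<epsilon> \<ge> 1\<close> the bias is eventually 0 and \<open>e = 1 / 2\<close> will do; otherwise half of \<open>\<epsilon>\<close> absorbs rounding.\<close>
  define e where "e = min \<epsilon> 1 / 2"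
  have e: "0 < e" "e \<le> 1 / 2" "2 * e \<le> \<epsilon>" using \<epsilon> by (auto simp: e_def)
  define p where "p n = measure_pmf.prob (half_random_game n (a n) (attack_strategy n (a n)))
      {h. \<not> connected_graph n (maker_edges (a n) h)}" for n
  have "\<forall>\<^sub>F n in sequentially. (real n)\<^sup>2 * c \<le> real n * (real n - 1) / 2
       - (real n * exp (d * ln (ln (real n))) + 1) * (ln (ln (real n)) + 1)"
    if "0 < d" "d < 1" "c < 1 / 2" for c d :: real
    using that by real_asymp
  from this[of "1 - e / 4" "1 / (2 * (1 + e / 8))"] e
  have "\<forall>\<^sub>F n in sequentially. (real n)\<^sup>2 / (2 * (1 + e / 8)) \<le> real n * (real n - 1) / 2
       - (real n * exp ((1 - e / 4) * ln (ln (real n))) + 1) * (ln (ln (real n)) + 1)"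
    by (simp add: divide_simps)
  moreover have "\<forall>\<^sub>F n in sequentially. 2 \<le> real n"
    "\<forall>\<^sub>F n in sequentially. 0 \<le> ln (ln (real n))"
    "\<forall>\<^sub>F n in sequentially. 2 \<le> exp ((1 - e / 4) * ln (ln (real n)))"
    "\<forall>\<^sub>F n in sequentially. (1 - 2 * e) * ln (ln (real n)) + 1 \<le> (1 - e) * ln (ln (real n))"
    "\<forall>\<^sub>F n in sequentially. 4 * (1 + e / 8) / real n \<le> e / 8"
    using e by real_asymp+
  ultimately have "\<forall>\<^sub>F n in sequentially. 1 - connection_bound e (real n) \<le> p n"
  proof eventually_elim
    case (elim n)
    have "max 0 ((1 - \<epsilon>) * ln (ln (real n))) \<le> (1 - 2 * e) * ln (ln (real n))"
      using e elim(3) mult_right_mono[of "1 - \<epsilon>" "1 - 2 * e" "ln (ln (real n))"] by simp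
    then have an: "real (a n) \<le> (1 - e) * ln (ln (real n))"
      using rounding_of_bounds(2)[OF a, of n] elim(5) by linarith
    have "1 - p n = measure_pmf.prob (half_random_game n (a n) (attack_strategy n (a n)))
        {h. connected_graph n (maker_edges (a n) h)}"
      unfolding p_def by (subst measure_pmf.prob_compl[symmetric]) (auto intro: arg_cong2[where f = measure])
    also have "\<dots> \<le> connection_bound e (real n)"
      by (rule prob_connected_le_connection_bound) (use e elim an in auto)
    finally show ?case by simp
  qed
  moreover have "(\<lambda>n. 1 - connection_bound e (real n)) \<longlonglongrightarrow> 1 - 0"
    using e by (intro tendsto_diff tendsto_const connection_bound_tendsto_0)
  moreover have "\<forall>\<^sub>F n in sequentially. p n \<le> 1" by (simp add: p_def)
  ultimately have "p \<longlonglongrightarrow> 1"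
    by (intro real_tendsto_sandwich[of "\<lambda>n. 1 - connection_bound e (real n)" p _ "\<lambda>_. 1" 1]) simp_all
  then show ?thesis unfolding maker_loses_aas_def p_def .
qed

theorem theorem1p4:
  "sharp_threshold_bias connected_graph (\<lambda>n. ln (ln (real n)))"
  unfolding sharp_threshold_bias_def
proof (intro allI impI conjI)
  fix \<epsilon> :: real and a :: "nat \<Rightarrow> nat" and S :: "nat \<Rightarrow> strategy"
  assume "0 < \<epsilon>" "rounding_of a (\<lambda>n. (1 + \<epsilon>) * ln (ln (real n)))" "\<forall>n. breaker_strategy n (a n) (S n)"
  then show "maker_wins_aas connected_graph a S" by (intro maker_wins_above_threshold) auto
next
  fix \<epsilon> :: real and a :: "nat \<Rightarrow> nat"
  assume "0 < \<epsilon>" "rounding_of a (\<lambda>n. (1 - \<epsilon>) * ln (ln (real n)))"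
  then show "\<exists>S. (\<forall>n. breaker_strategy n (a n) (S n)) \<and> maker_loses_aas connected_graph a S"
    by (intro exI[of _ "\<lambda>n. attack_strategy n (a n)"] conjI allI
        breaker_strategy_attack_strategy maker_loses_below_threshold)
qed

end
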